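(* For each integer $n>0$ let $d_{2n}$, $S_n$ and $I_n$ be as defined in the context. The following statements are equivalent: (1) There exists an integer $n>0$ such that the fractional part of $\log S_n$ is equal to $d_{2n}I_n$. (2) For all sufficiently large integers $n$, the fractional part of $\log S_n$ is equal to $d_{2n}I_n$. (3) Euler's constant $\gamma$ is a rational number.
   Context: Euler's constant is $\gamma := \lim_{N\to\infty}(H_N-\log N)$, where $H_N := \sum_{k=1}^N \frac1k$. For $n\ge 1$, $d_n := \mathrm{LCM}(1,2,\dots,n)$ is the least common multiple of the first $n$ positive integers. The fractional part of a real number $x$ is $x-\lfloor x\rfloor$. For an integer $n>0$, $S_n$ is the positive integer $$S_n := \prod_{m=1}^n \ \prod_{k=0}^{\min(m-1,\,n-m)}\ \prod_{j=k+1}^{n-k} (n+m)^{\binom{n}{k}^2\frac{2d_{2n}}{j}}.$$ The hypergeometric function ${}_3F_2$ is $${}_3F_2\biggl(\begin{matrix} a,\,b,\,c\\ d,\,e\end{matrix}\;\bigg|\; z\biggr) := \sum_{k=0}^\infty \frac{(a)_k(b)_k(c)_k}{k!\,(d)_k(e)_k}z^k,$$ where $(a)_0:=1$ and $(a)_k := a(a+1)\cdots(a+k-1)$ for $k>0$; for positive real parameters and $z=1$ the series converges if $a+b+c<d+e$. For an integer $n>0$, $I_n$ is the (convergent) integral $$I_n := \int_{n+1}^\infty \frac{(n!)^2\,\Gamma(t)}{(2n+1)\,\Gamma(2n+1+t)}\ {}_3F_2\biggl(\begin{matrix} n+1,\,n+1,\,2n+1\\ 2n+2,\,2n+1+t\end{matrix}\;\bigg|\;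 1\biggr)\,dt.$$ *)

theory Defs
  imports "HOL-Analysis.Analysis"
begin

definition lcm_upto :: "nat \<Rightarrow> nat" where
  "lcm_upto n = Lcm {1..n}"

(* The division in the exponent is exact for n > 0: there 1 \<le> j \<le> n, so j divides lcm_upto (2 * n). *)
definition Sondow_S :: "nat \<Rightarrow> nat" where
  "Sondow_S n = (\<Prod>m = 1..n. \<Prod>k = 0..min (m - 1) (n - m). \<Prod>j = k + 1..n - k.
            (n + m) ^ ((n choose k)\<^sup>2 * (2 * lcm_upto (2 * n) div j)))"

definition hypergeo_3F2 :: "real \<Rightarrow> real \<Rightarrow> real \<Rightarrow> real \<Rightarrow> real \<Rightarrow> real \<Rightarrow> real" where
  "hypergeo_3F2 a b c d e z =
     (\<Sum>k. pochhammer a k * pochhammer b k * pochhammer c k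
            / (fact k * pochhammer d k * pochhammer e k) * z ^ k)"

(* The Henstock--Kurzweil integral over an unbounded interval subsumes convergent improper integrals. *)
definition Sondow_I :: "nat \<Rightarrow> real" where
  "Sondow_I n = integral {real n + 1..}
     (\<lambda>t. (fact n)\<^sup>2 * Gamma t / ((2 * real n + 1) * Gamma (2 * real n + 1 + t))
          * hypergeo_3F2 (real n + 1) (real n + 1) (2 * real n + 1)
                         (2 * real n + 2) (2 * real n + 1 + t) 1)"

end

theory Submission
  imports Defs
begin

text \<open>
  Put \<open>g(s) = (n! / (s (s+1) \<cdots> (s+n)))\<^sup>2\<close>, \<open>C\<^sub>k = (n choose k)\<close> and
  \<open>B\<^sub>k = 2 C\<^sub>k\<^sup>2 (H\<^sub>k - H\<^bsub>n-k\<^esub>)\<close>. If \<open>G(t)\<close> is the integrand of \<open>I\<^sub>n\<close>, Gauss's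
  summation theorem yields \<open>G(t) - G(t+1) = g(t)\<close>, hence \<open>G(t)\<close> is the sum of \<open>g(t+\<nu>)\<close> over
  \<open>\<nu> \<ge> 0\<close>. Expanding \<open>g\<close> into partial fractions \<open>C\<^sub>k\<^sup>2 / (s+k)\<^sup>2 + B\<^sub>k / (s+k)\<close> and
  integrating termwise gives
  \<open>I\<^sub>n = (2n choose n) \<gamma> - A\<^sub>n + ln S\<^sub>n / d\<^bsub>2n\<^esub>\<close>, where \<open>A\<^sub>n\<close> is the sum of
  \<open>C\<^sub>k\<^sup>2 H\<^bsub>n+k\<^esub>\<close> and \<open>d\<^bsub>2n\<^esub> A\<^sub>n\<close> is an integer. Since moreover \<open>0 \<le> d\<^bsub>2n\<^esub> I\<^sub>n < 1\<close>, the fractional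
  part of \<open>ln S\<^sub>n\<close> is \<open>d\<^bsub>2n\<^esub> I\<^sub>n\<close> if and only if \<open>d\<^bsub>2n\<^esub> (2n choose n) \<gamma>\<close> is an integer. The upper
  bound combines \<open>d\<^bsub>2n\<^esub> \<le> 4\<^bsup>2n-1\<^esup>\<close> with
  \<open>I\<^sub>n \<le> 1 / (2 n\<^sup>2 (2n choose n)\<^sup>2)\<close> and \<open>16\<^sup>n \<le> 4 n (2n choose n)\<^sup>2\<close>.
\<close>

section \<open>Upper bound for the least common multiple\<close>

text \<open>Legendre's formula, cut off at any \<open>M\<close> beyond which all quotients vanish,
  so that several factorials can share one cut-off. In the induction, \<open>n div p ^ i\<close>
  grows by one exactly for those \<open>i\<close> with \<open>p ^ i dvd Suc n\<close>.\<close>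

lemma multiplicity_fact_legendre:
  fixes p :: nat
  assumes p: "prime p" and M: "n < p ^ Suc M"
  shows "multiplicity p (fact n :: nat) = (\<Sum>i=1..M. n div p ^ i)"
  using M
proof (induction n)
  case (Suc n)
  have p1: "1 < p" using p prime_gt_1_nat by blast
  have pn: "prime_elem p" using p by auto
  have bound: "multiplicity p (Suc n) \<le> M"
  proof -
    have "p ^ multiplicity p (Suc n) \<le> Suc n"
      by (rule dvd_imp_le[OF multiplicity_dvd]) simp
    also have "\<dots> < p ^ Suc M" using Suc.prems .
    finally show ?thesis using p1 power_less_imp_less_exp less_Suc_eq_le by metis
  qed
  have step: "Suc n div q = n div q + (if q dvd Suc n then 1 else 0)" for q :: nat
    by (simp add: div_Suc dvd_eq_mod_eq_0)
  have "(\<Sum>i=1..M. if p ^ i dvd Suc n then 1 else 0) = card {i\<in>{1..M}. p ^ i dvd Suc n}"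
    by (simp add: sum.If_cases Int_def)
  also have "{i\<in>{1..M}. p ^ i dvd Suc n} = {1..multiplicity p (Suc n)}"
    using bound p1 by (auto simp: power_dvd_iff_le_multiplicity)
  finally have mult: "(\<Sum>i=1..M. if p ^ i dvd Suc n then 1 else 0) = multiplicity p (Suc n)"
    by simp
  have "multiplicity p (fact (Suc n) :: nat) = multiplicity p (Suc n * fact n)"
    by (simp only: fact_Suc of_nat_id)
  also have "\<dots> = multiplicity p (Suc n) + multiplicity p (fact n :: nat)"
    by (rule prime_elem_multiplicity_mult_distrib[OF pn]) auto
  also have "multiplicity p (fact n :: nat) = (\<Sum>i=1..M. n div p ^ i)"
    using Suc by simp
  also have "multiplicity p (Suc n) + (\<Sum>i=1..M. n div p ^ i) = (\<Sum>i=1..M. Suc n div p ^ i)"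
    unfolding step sum.distrib mult by simp
  finally show ?case .
qed auto

lemma lcm_upto_pos: "lcm_upto n > 0"
  unfolding lcm_upto_def by (rule gr0I) (simp add: Lcm_0_iff)

lemma dvd_lcm_upto: "0 < j \<Longrightarrow> j \<le> n \<Longrightarrow> j dvd lcm_upto n"
  unfolding lcm_upto_def by (rule dvd_Lcm) auto

text \<open>A prime power between \<open>max h h'\<close> and \<open>h + h'\<close> contributes one factor to the binomial
  coefficient by Legendre's formula.\<close>
lemma lcm_upto_add_dvd:
  assumes "h \<le> h'"
  shows "lcm_upto (h + h') dvd lcm_upto h' * ((h + h') choose h)"
proof -
  define m where "m = h + h'"
  have "j dvd lcm_upto h' * (m choose h)" if j: "j \<in> {1..m}" for j
  proof (rule multiplicity_le_imp_dvd)
    show "j \<noteq> 0" using j by simp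
    fix p :: nat assume p: "prime p"
    then have p1: "1 < p" and pn: "prime_elem p" using prime_gt_1_nat by auto
    have pgt: "i < p ^ i" for i
      using power_gt_expt[of p i] p1 by simp
    define e where "e = multiplicity p j"
    \<comment> \<open>The exponent of the largest power of \<open>p\<close> not exceeding
      \<open>h'\<close>. The alternative \<open>i = 0\<close> keeps the set nonempty when
      \<open>h' = 0\<close>.\<close>
    define f where "f = Max {i. p ^ i \<le> h' \<or> i = 0}"
    have fin: "finite {i. p ^ i \<le> h' \<or> i = 0}"
    proof (rule finite_subset)
      show "{i. p ^ i \<le> h' \<or> i = 0} \<subseteq> {..h'}"
      proof
        fix i assume "i \<in> {i. p ^ i \<le> h' \<or> i = 0}"
        then show "i \<in> {..h'}" using pgt[of i] by auto
      qed
    qed simp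
    have "f \<in> {i. p ^ i \<le> h' \<or> i = 0}"
      unfolding f_def by (rule Max_in[OF fin]) auto
    then have f_in: "p ^ f \<le> h' \<or> f = 0" by simp
    have f_big: "h' < p ^ i" if "f < i" for i
      using Max_ge[OF fin, of i] that unfolding f_def by (force simp: not_le[symmetric])
    have pe: "p ^ e \<le> m"
    proof -
      have "p ^ e \<le> j" unfolding e_def
        by (rule dvd_imp_le[OF multiplicity_dvd]) (use j in simp)
      then show ?thesis using j by simp
    qed
    define M where "M = m"
    have big: "m < p ^ Suc M"
      using pgt[of "Suc M"] unfolding M_def by (simp del: power_Suc)
    have eM: "e \<le> M"
      using pgt[of e] pe unfolding M_def by simp
    have fdvd: "p ^ f dvd lcm_upto h'"
    proof (cases "f = 0")
      case False
      then show ?thesis using f_in p1 by (intro dvd_lcm_upto) auto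
    qed simp
    have mult_l: "f \<le> multiplicity p (lcm_upto h')"
      using fdvd p1 lcm_upto_pos[of h'] by (subst power_dvd_iff_le_multiplicity[symmetric]) auto
    have fact_eq: "fact h * fact h' * (m choose h) = (fact m :: nat)"
      using binomial_fact_lemma[of h m] unfolding m_def by simp
    have c0: "m choose h \<noteq> 0" unfolding m_def by simp
    have "multiplicity p (fact m :: nat) =
        multiplicity p (fact h :: nat) + multiplicity p (fact h' :: nat) + multiplicity p (m choose h)"
      unfolding fact_eq[symmetric] using c0
      by (simp add: prime_elem_multiplicity_mult_distrib[OF pn])
    then have leg: "(\<Sum>i=1..M. m div p ^ i) =
        (\<Sum>i=1..M. h div p ^ i + h' div p ^ i) + multiplicity p (m choose h)"
      using big m_def by (simp add: multiplicity_fact_legendre[OF p, of _ M] sum.distrib)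
    \<comment> \<open>The powers with exponents \<open>f + 1, ..., e\<close> exceed
      \<open>h'\<close> but not \<open>m\<close>: for them both quotients on the left are 0, while
      \<open>m div p ^ i\<close> is positive and pays for the extra 1.\<close>
    have "(\<Sum>i=1..M. h div p ^ i + h' div p ^ i) + (e - f)
        = (\<Sum>i=1..M. h div p ^ i + h' div p ^ i) + (\<Sum>i=1..M. if i \<in> {f+1..e} then 1 else 0)"
    proof -
      have "{f + 1..e} \<subseteq> {1..M}" using eM by auto
      then have "e - f = (\<Sum>i\<in>{1..M} \<inter> {f + 1..e}. 1)" by (simp add: eM)
      then show ?thesis by (simp only: sum.inter_restrict[OF finite_atLeastAtMost])
    qed
    also have "\<dots> \<le> (\<Sum>i=1..M. m div p ^ i)"
      unfolding sum.distrib[symmetric]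
    proof (rule sum_mono)
      fix i assume "i \<in> {1..M}"
      show "h div p ^ i + h' div p ^ i + (if i \<in> {f+1..e} then 1 else 0) \<le> m div p ^ i"
      proof (cases "i \<in> {f+1..e}")
        case True
        then have "h' < p ^ i" using f_big by auto
        moreover have "p ^ i \<le> p ^ e"
          using True p1 by (intro power_increasing) auto
        moreover have "0 < p ^ i" using p1 by simp
        ultimately have "h div p ^ i = 0" "h' div p ^ i = 0" "0 < m div p ^ i"
          using assms pe by (simp_all add: div_greater_zero_iff)
        then show ?thesis by simp
      next
        case False
        have "h div p ^ i + h' div p ^ i \<le> m div p ^ i"
          unfolding m_def using div_add1_eq[of h h' "p ^ i"] by linarith
        then show ?thesis using False by auto
      qed
    qed
    finally have "e - f \<le> multiplicity p (m choose h)" using leg by linarith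
    then have "e \<le> multiplicity p (lcm_upto h') + multiplicity p (m choose h)"
      using mult_l by linarith
    also have "\<dots> = multiplicity p (lcm_upto h' * (m choose h))"
      using c0 lcm_upto_pos[of h'] by (simp add: prime_elem_multiplicity_mult_distrib[OF pn])
    finally show "multiplicity p j \<le> multiplicity p (lcm_upto h' * (m choose h))"
      unfolding e_def .
  qed
  then show ?thesis unfolding m_def lcm_upto_def[of "h + h'"] by (intro Lcm_least) auto
qed

lemma lcm_upto_add_le:
  assumes "h \<le> h'"
  shows "lcm_upto (h + h') \<le> lcm_upto h' * ((h + h') choose h)"
  using lcm_upto_add_dvd[OF assms] lcm_upto_pos[of h'] by (intro dvd_imp_le) auto

text \<open>By symmetry the first \<open>r + 1\<close> entries of row \<open>2 * r + 1\<close> sum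
  to half of \<open>2 ^ (2 * r + 1)\<close>.\<close>

lemma choose_middle_le: "(2 * r + 1) choose r \<le> 4 ^ r"
proof -
  have "(2 * r + 1) choose r \<le> (\<Sum>k\<le>r. (2 * r + 1) choose k)"
    by (rule member_le_sum) auto
  then show ?thesis unfolding binomial_r_part_sum by (simp add: power_mult)
qed

text \<open>Strong induction by halving \<open>m\<close>: the larger half goes through the induction
  hypothesis, and the binomial coefficient costs at most \<open>4 ^ r\<close>.\<close>

lemma lcm_upto_le: "m > 0 \<Longrightarrow> lcm_upto m \<le> 4 ^ (m - 1)"
proof (induction m rule: less_induct)
  case (less m)
  consider "m = 1" | r where "m = 2 * r" "r > 0" | r where "m = 2 * r + 1" "r > 0"
    using less.prems by (metis One_nat_def Suc_eq_plus1 gr0I mult_0_right nat_0_less_mult_iff oddE evenE)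
  then show ?case
  proof cases
    case 1
    then show ?thesis by (simp add: lcm_upto_def)
  next
    case 2
    have "lcm_upto m \<le> lcm_upto r * ((2 * r) choose r)"
      using lcm_upto_add_le[of r r] 2 by (simp add: mult_2)
    also have "\<dots> \<le> 4 ^ (r - 1) * 4 ^ r"
    proof (rule mult_mono)
      show "lcm_upto r \<le> 4 ^ (r - 1)" using less.IH[of r] 2 by auto
      show "(2 * r) choose r \<le> 4 ^ r"
        using binomial_le_pow2[of "2 * r" r] by (simp add: power_mult)
    qed auto
    also have "\<dots> = 4 ^ (m - 1)" using 2 by (simp flip: power_add add: mult_2)
    finally show ?thesis .
  next
    case 3
    have "lcm_upto m \<le> lcm_upto (r + 1) * ((2 * r + 1) choose r)"
      using lcm_upto_add_le[of r "r + 1"] 3 by (simp add: mult_2 add.assoc)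
    also have "\<dots> \<le> 4 ^ r * 4 ^ r"
    proof (rule mult_mono)
      show "lcm_upto (r + 1) \<le> 4 ^ r" using less.IH[of "r + 1"] 3 by auto
    qed (use choose_middle_le in auto)
    also have "\<dots> = 4 ^ (m - 1)" using 3 by (simp flip: power_add add: mult_2)
    finally show ?thesis .
  qed
qed

text \<open>Equality holds at \<open>n = 1\<close>. The recursion of the central binomial
  coefficients is used multiplied by \<open>Suc n\<close>; what remains is that
  \<open>4 * n * Suc n\<close> is at most the square of \<open>2 * n + 1\<close>.\<close>

lemma central_binomial_square_ge: "n > 0 \<Longrightarrow> 16 ^ n \<le> 4 * n * ((2 * n) choose n)\<^sup>2"
proof (induction n rule: nat_induct_non_zero)
  case (Suc n)
  have rec: "Suc n * ((2 * Suc n) choose Suc n) = 2 * (2 * n + 1) * ((2 * n) choose n)"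
  proof -
    have "Suc n * (Suc (2*n+1) choose Suc n) = Suc (2*n+1) * ((2*n+1) choose n)"
      by (rule Suc_times_binomial)
    also have "(2*n+1) choose n = (2*n+1) choose Suc n"
      by (subst binomial_symmetric) auto
    finally have "Suc n * (2 * Suc n choose Suc n) = 2 * (Suc n * ((2*n+1) choose Suc n))" by simp
    also have "Suc n * ((2*n+1) choose Suc n) = (2*n+1) * ((2*n) choose n)"
      using Suc_times_binomial[of n "2*n"] by simp
    finally show ?thesis by simp
  qed
  have "Suc n * 16 ^ Suc n \<le> 16 * Suc n * (4 * n * ((2 * n) choose n)\<^sup>2)"
    using mult_le_mono2[OF Suc.IH, of "16 * Suc n"] by (simp only: power_Suc mult_ac)
  also have "\<dots> = 16 * (4 * n * Suc n) * ((2 * n) choose n)\<^sup>2" by (simp only: mult_ac)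
  also have "\<dots> \<le> 16 * (2 * n + 1)\<^sup>2 * ((2 * n) choose n)\<^sup>2"
    by (intro mult_le_mono) (auto simp: power2_eq_square)
  also have "\<dots> = 4 * (Suc n * ((2 * Suc n) choose Suc n))\<^sup>2"
    unfolding rec by (simp only: power_mult_distrib) simp
  also have "\<dots> = Suc n * (4 * Suc n * ((2 * Suc n) choose Suc n)\<^sup>2)"
    by (simp only: power2_eq_square mult_ac)
  finally show ?case by (simp only: mult_le_cancel1)
qed simp

section \<open>Gauss's summation theorem and the integrand\<close>

text \<open>The summand of the Gauss series 2F1(a, b; c; 1). The parameter \<open>a\<close> is a
  natural number because Gauss's theorem is proved by induction on it.\<close>

definition gauss_term :: "nat \<Rightarrow> real \<Rightarrow> real \<Rightarrow> nat \<Rightarrow> real" where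
  "gauss_term a b c k = pochhammer (real a) k * pochhammer b k / (fact k * pochhammer c k)"

lemma gauss_term_nonneg:
  assumes "b > 0" "c > 0"
  shows "gauss_term a b c k \<ge> 0"
proof -
  have "pochhammer (real a) k \<ge> 0"
    by (cases "a = 0") (auto simp: pochhammer_0_left intro!: pochhammer_nonneg)
  then show ?thesis
    unfolding gauss_term_def using pochhammer_pos[OF assms(1), of k] pochhammer_pos[OF assms(2), of k]
    by (intro divide_nonneg_nonneg mult_nonneg_nonneg) auto
qed

text \<open>The contiguous relation between the series for \<open>a\<close> and
  \<open>Suc a\<close>. With T(k) = \<open>(b + k) * gauss_term (Suc a) b c k\<close>, the summand
  at \<open>k > 0\<close> is T(k-1) - T(k) and the summand at 0 is -T(0); the \<open>case\<close>
  covers the empty sum.\<close>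

lemma gauss_term_telescope:
  fixes b c :: real
  assumes "c > 0"
  shows "(\<Sum>k<K. (c - a - b - 1) * gauss_term (Suc a) b c k - (c - a - 1) * gauss_term a b c k)
    = - (case K of 0 \<Rightarrow> 0 | Suc k \<Rightarrow> (b + k) * gauss_term (Suc a) b c k)"
proof (induction K)
  case (Suc K)
  show ?case
  proof (cases K)
    case 0
    then show ?thesis by (simp add: gauss_term_def)
  next
    case (Suc k)
    define w where "w = pochhammer (real a + 1) k * pochhammer b k / (fact k * pochhammer c k)"
    have cpos: "c + real k > 0" "pochhammer c k > 0" using assms by (auto intro: pochhammer_pos)
    have w0: "gauss_term (Suc a) b c k = w"
      unfolding w_def gauss_term_def by (simp add: add.commute)
    have w1: "gauss_term (Suc a) b c (Suc k) = w * ((a + 1 + k) * (b + k) / ((k + 1) * (c + k)))"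
      by (simp only: w_def gauss_term_def pochhammer_Suc fact_Suc times_divide_times_eq) (simp add: ac_simps)
    have "pochhammer (real a) (Suc k) = real a * pochhammer (real a + 1) k"
      by (rule pochhammer_rec)
    then have w2: "gauss_term a b c (Suc k) = w * (a * (b + k) / ((k + 1) * (c + k)))"
      by (simp only: w_def gauss_term_def pochhammer_Suc[of b] pochhammer_Suc[of c] fact_Suc times_divide_times_eq)
        (simp add: ac_simps)
    have key: "- ((b + k) * w) + ((c - a - b - 1) * (w * ((a + 1 + k) * (b + k) / ((k + 1) * (c + k))))
        - (c - a - 1) * (w * (a * (b + k) / ((k + 1) * (c + k)))))
      = - ((b + (k + 1)) * (w * ((a + 1 + k) * (b + k) / ((k + 1) * (c + k)))))"
    proof -
      \<comment> \<open>Both terms at index \<open>k + 1\<close> are multiples of \<open>q\<close>,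
        and so is \<open>w * (b + k)\<close>; after this substitution the claim is a polynomial
        identity.\<close>
      define q where "q = w * (b + k) / ((k + 1) * (c + k))"
      have "w * (b + k) = q * ((k + 1) * (c + k))"
        unfolding q_def using cpos by simp
      moreover have "w * ((a + 1 + k) * (b + k) / ((k + 1) * (c + k))) = q * (a + 1 + k)"
        "w * (a * (b + k) / ((k + 1) * (c + k))) = q * a"
        unfolding q_def by simp_all
      ultimately show ?thesis by (simp only: mult.commute[of "b + real k" w]) (simp add: algebra_simps)
    qed
    then show ?thesis
      using Suc.IH \<open>K = Suc k\<close> by (simp add: w0 w1 w2 add.commute)
  qed
qed simp

text \<open>The boundary term \<open>(b + k) * gauss_term (Suc a) b c k\<close> of the
  telescoping sum converges; a nonzero limit would contradict summability of the series by
  comparison with the harmonic series.\<close>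
lemma gauss_sums:
  assumes "b > 0" "c > a + b"
  shows "gauss_term a b c sums (pochhammer (c - a) a / pochhammer (c - a - b) a)"
  using assms(2)
proof (induction a)
  case 0
  have "gauss_term 0 b c = (\<lambda>k. if k = 0 then 1 else 0)"
    by (auto simp: gauss_term_def pochhammer_0_left)
  then show ?case using sums_single[of 0 "\<lambda>_. 1 :: real"] by simp
next
  case (Suc a)
  have c: "c > 0" and ca: "c > a + b" and d: "c - a - b - 1 > 0" and e: "c - a - 1 > 0"
    using Suc.prems assms by auto
  let ?u = "gauss_term a b c" and ?v = "gauss_term (Suc a) b c"
  have IH: "?u sums (pochhammer (c - a) a / pochhammer (c - a - b) a)" (is "_ sums ?S")
    using Suc.IH ca by simp
  have tele: "(c - a - b - 1) * (\<Sum>k<Suc K. ?v k) = (c - a - 1) * (\<Sum>k<Suc K. ?u k) - (b + K) * ?v K" for K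
    using gauss_term_telescope[OF c, of a b "Suc K"]
    by (simp add: sum_subtractf sum_distrib_left del: sum.lessThan_Suc)
  \<comment> \<open>The boundary term in \<open>tele\<close> is nonnegative. Dropping it bounds the
    partial sums by the known value for \<open>a\<close>, which makes the series for
    \<open>Suc a\<close> summable.\<close>
  have vb: "(\<Sum>k<K. ?v k) \<le> (c - a - 1) * ?S / (c - a - b - 1)" for K
  proof -
    have "(\<Sum>k<K. ?v k) \<le> (\<Sum>k<Suc K. ?v k)" using gauss_term_nonneg[OF assms(1) c] by simp
    also have "\<dots> \<le> (c - a - 1) * ?S / (c - a - b - 1)"
    proof (subst pos_le_divide_eq[OF d])
      have "(c - a - b - 1) * (\<Sum>k<Suc K. ?v k) \<le> (c - a - 1) * (\<Sum>k<Suc K. ?u k)"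
        unfolding tele using gauss_term_nonneg[OF assms(1) c, of "Suc a" K] assms(1) by simp
      also have "(\<Sum>k<Suc K. ?u k) \<le> ?S"
        using sum_le_suminf[of ?u "{..<Suc K}"] IH gauss_term_nonneg[OF assms(1) c]
        by (simp add: sums_iff)
      finally show "(\<Sum>k<Suc K. ?v k) * (c - a - b - 1) \<le> (c - a - 1) * ?S"
        using e by (simp add: mult_left_mono mult.commute)
    qed
    finally show ?thesis .
  qed
  have sv: "summable ?v"
    by (rule summableI_nonneg_bounded[OF gauss_term_nonneg[OF assms(1) c] vb])
  define L where "L = (c - a - 1) * ?S - (c - a - b - 1) * suminf ?v"
  have "(\<lambda>K. (c - a - 1) * (\<Sum>k<Suc K. ?u k) - (c - a - b - 1) * (\<Sum>k<Suc K. ?v k)) \<longlonglongrightarrow> L"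
    unfolding L_def
    by (intro tendsto_intros LIMSEQ_Suc[OF IH[unfolded sums_def]]
        LIMSEQ_Suc[OF summable_LIMSEQ[OF sv]])
  then have lim: "(\<lambda>K. (b + K) * ?v K) \<longlonglongrightarrow> L" unfolding tele by simp
  have "L \<ge> 0"
    by (rule tendsto_lowerbound[OF lim]) (use assms(1) gauss_term_nonneg[OF assms(1) c] in auto)
  moreover have "\<not> L > 0"
  proof
    assume L: "L > 0"
    have "\<forall>\<^sub>F K in sequentially. L / 2 < (b + K) * ?v K"
      by (rule order_tendstoD[OF lim]) (use L in simp)
    then have "\<forall>\<^sub>F K in sequentially. norm (1 / (b + real K)) \<le> 2 / L * ?v K"
    proof eventually_elim
      case (elim K)
      then show ?case using L assms(1) by (simp add: field_simps)
    qed
    then have "summable (\<lambda>K. 1 / (b + real K))"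
      by (rule summable_comparison_test_ev) (intro summable_mult sv)
    then have s: "summable (\<lambda>K. (b + 1) * (1 / (b + real K)))" by (rule summable_mult)
    have "summable (\<lambda>K. 1 / (real (Suc K)))"
    proof (rule summable_comparison_test'[OF s])
      fix K :: nat
      show "norm (1 / real (Suc K)) \<le> (b + 1) * (1 / (b + real K))"
        using assms(1) by (simp add: field_simps)
    qed
    then show False
      using not_summable_harmonic[where ?'a = real] summable_Suc_iff[of "\<lambda>n. 1 / real n"]
      by (simp add: inverse_eq_divide)
  qed
  ultimately have "L = 0" by simp
  then have "(c - a - b - 1) * suminf ?v = (c - a - 1) * ?S" unfolding L_def by simp
  then have "suminf ?v = (c - a - 1) * ?S / (c - a - b - 1)"
    using d by (metis nonzero_mult_div_cancel_left less_irrefl)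
  also have "\<dots> = pochhammer (c - Suc a) (Suc a) / pochhammer (c - Suc a - b) (Suc a)"
  proof -
    have "pochhammer (c - Suc a) (Suc a) = (c - a - 1) * pochhammer (c - a) a"
      "pochhammer (c - Suc a - b) (Suc a) = (c - a - b - 1) * pochhammer (c - a - b) a"
      by (simp_all add: pochhammer_rec algebra_simps)
    then show ?thesis by simp
  qed
  finally show ?case using sv by (simp add: sums_iff)
qed

section \<open>Telescoping of the integrand in unit steps\<close>

definition sondow_density :: "nat \<Rightarrow> real \<Rightarrow> real" where
  "sondow_density n s = (fact n / pochhammer s (Suc n))\<^sup>2"

definition sondow_integrand :: "nat \<Rightarrow> real \<Rightarrow> real" where
  "sondow_integrand n t = (fact n)\<^sup>2 * Gamma t / ((2 * real n + 1) * Gamma (2 * real n + 1 + t))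
          * hypergeo_3F2 (real n + 1) (real n + 1) (2 * real n + 1)
                         (2 * real n + 2) (2 * real n + 1 + t) 1"

text \<open>The factor \<open>2n+1+k\<close> comes from \<open>(2n+1)\<^sub>k / (2n+2)\<^sub>k = (2n+1) / (2n+1+k)\<close> in the hypergeometric series.\<close>
definition sondow_term :: "nat \<Rightarrow> real \<Rightarrow> nat \<Rightarrow> real" where
  "sondow_term n t k = (fact (n + k))\<^sup>2 / (fact k * real (2*n+1+k) * pochhammer t (2*n+1+k))"

lemma fact_times_pochhammer: "fact n * pochhammer (real n + 1) k = fact (n + k)"
  using pochhammer_product'[of "1 :: real" n k] by (simp add: pochhammer_fact add.commute)

text \<open>In the difference the factor \<open>2n+1+k\<close> cancels, leaving a multiple of the
  Gauss summand with a = b = n+1 and c = t+2n+2, where c-a-b = t is positive. Gauss's value cancels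
  the upper half of \<open>pochhammer t (2*n+2)\<close> and doubles the lower half.\<close>

lemma sondow_term_step:
  assumes "t > 0"
  shows "(\<lambda>k. sondow_term n t k - sondow_term n (t + 1) k) sums sondow_density n t"
proof -
  have eq: "sondow_term n t k - sondow_term n (t + 1) k =
      (fact n)\<^sup>2 / pochhammer t (2*n+2) * gauss_term (Suc n) (real n + 1) (t + (2*n+2)) k" for k
  proof -
    define m where "m = 2*n+1+k"
    define P where "P = pochhammer t m"
    have P: "P > 0" unfolding P_def using assms by (rule pochhammer_pos)
    have P1: "pochhammer (t + 1) m = P * (t + m) / t"
      using assms pochhammer_rec[of t m] pochhammer_rec'[of t m] unfolding P_def
      by (simp add: field_simps)
    have P2: "pochhammer t (2*n+2) * pochhammer (t + (2*n+2)) k = P * (t + m)"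
      using pochhammer_product'[of t "2*n+2" k] pochhammer_rec'[of t m] unfolding P_def m_def
      by (simp add: add.commute mult.commute)
    have "sondow_term n t k - sondow_term n (t + 1) k =
        (fact (n + k))\<^sup>2 / (fact k * m) * (1 / P - t / (P * (t + m)))"
      unfolding sondow_term_def m_def[symmetric] P1 P_def[symmetric] using assms
      by (simp add: right_diff_distrib)
    also have "1 / P - t / (P * (t + m)) = m / (P * (t + m))"
    proof -
      have tm: "t + m > 0" using assms by simp
      have "1 / P = (t + m) / (P * (t + m))" using tm by simp
      then have "1 / P - t / (P * (t + m)) = (t + m) / (P * (t + m)) - t / (P * (t + m))" by simp
      then show ?thesis by (simp only: diff_divide_distrib[symmetric]) simp
    qed
    also have "(fact (n + k))\<^sup>2 / (fact k * m) * (m / (P * (t + m))) =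
        (fact (n + k))\<^sup>2 / (fact k * (P * (t + m)))"
    proof -
      have "real m > 0" unfolding m_def by simp
      then show ?thesis by simp
    qed
    also have "\<dots> = (fact n)\<^sup>2 / pochhammer t (2*n+2) * gauss_term (Suc n) (real n + 1) (t + (2*n+2)) k"
      unfolding P2[symmetric] gauss_term_def fact_times_pochhammer[symmetric]
      by (simp add: power_mult_distrib power2_eq_square add.commute mult_ac)
    finally show ?thesis .
  qed
  have "gauss_term (Suc n) (real n + 1) (t + (2*n+2)) sums
      (pochhammer (t + (n + 1)) (Suc n) / pochhammer t (Suc n))"
    using gauss_sums[of "real n + 1" "Suc n" "t + (2*n+2)"] assms by (simp add: algebra_simps)
  from sums_mult[OF this, of "(fact n)\<^sup>2 / pochhammer t (2*n+2)"]
  have "(\<lambda>k. sondow_term n t k - sondow_term n (t + 1) k) sums ((fact n)\<^sup>2 / pochhammer t (2*n+2) *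
     (pochhammer (t + (n + 1)) (Suc n) / pochhammer t (Suc n)))"
    unfolding eq .
  moreover have "pochhammer t (2*n+2) = pochhammer t (Suc n) * pochhammer (t + (n + 1)) (Suc n)"
    using pochhammer_product'[of t "Suc n" "Suc n"] by (simp add: mult_2 add.commute)
  moreover have "pochhammer (t + (n + 1)) (Suc n) > 0" using assms by (intro pochhammer_pos) auto
  ultimately show ?thesis unfolding sondow_density_def
    by (simp add: power_divide power2_eq_square)
qed

lemma sondow_term_nonneg: "t > 0 \<Longrightarrow> sondow_term n t k \<ge> 0"
  unfolding sondow_term_def using pochhammer_nonneg[of t "2*n+1+k"]
  by (intro divide_nonneg_nonneg mult_nonneg_nonneg) auto

text \<open>Only the first factor of the Pochhammer symbol is evaluated exactly, the others merely
  increase with the argument. The gain \<open>t / (t + N)\<close> serves twice: for summability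
  (\<open>N = 1\<close>) and for the vanishing of the telescoping remainder.\<close>

lemma sondow_term_shift:
  assumes "t > 0"
  shows "sondow_term n (t + real N) k \<le> t / (t + real N) * sondow_term n t k"
proof -
  define m where "m = 2*n+k"
  have mono: "pochhammer (t + 1) m \<le> pochhammer (t + N + 1) m"
    unfolding pochhammer_prod by (rule prod_mono) (use assms in auto)
  have pos: "pochhammer (t + 1) m > 0" "pochhammer (t + N + 1) m > 0"
    using assms by (auto intro!: pochhammer_pos add_pos_nonneg)
  define A :: real where "A = (fact (n + k))\<^sup>2 / (fact k * real (2*n+1+k))"
  have A: "A \<ge> 0" unfolding A_def by simp
  have 1: "sondow_term n s k = A / (s * pochhammer (s + 1) m)" for s
    unfolding sondow_term_def A_def m_def using pochhammer_rec[of s "2*n+k"] by simp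
  have "A / pochhammer (t + N + 1) m \<le> A / pochhammer (t + 1) m"
    using A mono pos by (intro divide_left_mono) auto
  then have "A / pochhammer (t + N + 1) m / (t + N) \<le> A / pochhammer (t + 1) m / (t + N)"
    using assms by (intro divide_right_mono) auto
  moreover have "t / (t + real N) * (A / (t * pochhammer (t + 1) m)) = A / pochhammer (t + 1) m / (t + N)"
    using assms by simp
  ultimately show ?thesis unfolding 1 by (simp add: mult.commute)
qed

text \<open>The shift by 1 bounds each term by \<open>t + 1\<close> times its difference, and the
  series of differences converges by Gauss's theorem.\<close>

lemma summable_sondow_term:
  assumes "t > 0"
  shows "summable (sondow_term n t)"
proof (rule summable_comparison_test')
  show "summable (\<lambda>k. (t + 1) * (sondow_term n t k - sondow_term n (t + 1) k))"
    by (intro summable_mult sums_summable[OF sondow_term_step[OF assms]])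
  fix k
  have "sondow_term n (t + 1) k \<le> t / (t + 1) * sondow_term n t k"
    using sondow_term_shift[OF assms, of n 1 k] by simp
  then show "norm (sondow_term n t k) \<le> (t + 1) * (sondow_term n t k - sondow_term n (t + 1) k)"
    using assms sondow_term_nonneg[OF assms, of n k] by (simp add: field_simps)
qed

text \<open>With \<open>x = 2n+1\<close>, the quotient \<open>Gamma t / Gamma (x + t)\<close>
  supplies the first \<open>2n+1\<close> factors of the Pochhammer symbol in the denominator of
  \<open>sondow_term\<close>. The constant \<open>c\<close> is nonzero, so summability passes to the
  hypergeometric series and \<open>c\<close> can be pulled out.\<close>

lemma sondow_integrand_eq:
  assumes "t > 0"
  shows "sondow_integrand n t = suminf (sondow_term n t)"
proof -
  define x where "x = 2 * real n + 1"
  have nz: "t \<notin> \<int>\<^sub>\<le>\<^sub>0" "t + x \<notin> \<int>\<^sub>\<le>\<^sub>0" using assms unfolding x_def by (auto elim!: nonpos_Ints_cases)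
  have G: "Gamma (x + t) = pochhammer t (2*n+1) * Gamma t"
    using pochhammer_Gamma[OF nz(1), of "2*n+1"] Gamma_eq_zero_iff[of t] nz(1)
    by (simp add: x_def field_simps)
  have G0: "Gamma t \<noteq> 0" using nz(1) by (simp add: Gamma_eq_zero_iff)
  have summand: "(fact n)\<^sup>2 * Gamma t / (x * Gamma (x + t)) *
      (pochhammer (real n + 1) k * pochhammer (real n + 1) k * pochhammer x k
      / (fact k * pochhammer (x + 1) k * pochhammer (x + t) k) * 1 ^ k) = sondow_term n t k" for k
  proof -
    have x: "x > 0" unfolding x_def by simp
    have p: "pochhammer x k > 0" "pochhammer (x + 1) k > 0" using x by (auto intro!: pochhammer_pos)
    have q: "pochhammer x k / pochhammer (x + 1) k = x / (x + k)"
      using pochhammer_rec[of x k] pochhammer_rec'[of x k] p x by (simp add: field_simps)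
    have "pochhammer t (2*n+1) * pochhammer (x + t) k = pochhammer t (2*n+1+k)"
      using pochhammer_product'[of t "2*n+1" k] by (simp add: x_def add_ac)
    then have r: "Gamma t / (Gamma (x + t) * pochhammer (x + t) k) = 1 / pochhammer t (2*n+1+k)"
      unfolding G using G0 by (simp add: field_simps)
    have "(fact n)\<^sup>2 * Gamma t / (x * Gamma (x + t)) *
      (pochhammer (real n + 1) k * pochhammer (real n + 1) k * pochhammer x k
      / (fact k * pochhammer (x + 1) k * pochhammer (x + t) k) * 1 ^ k) =
      (fact n * pochhammer (real n + 1) k)\<^sup>2 / (x * fact k) * (pochhammer x k / pochhammer (x + 1) k)
      * (Gamma t / (Gamma (x + t) * pochhammer (x + t) k))"
      by (simp only: power_mult_distrib power2_eq_square times_divide_times_eq) (simp add: ac_simps)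
    also have "\<dots> = sondow_term n t k"
      unfolding q r fact_times_pochhammer sondow_term_def using x by (simp add: x_def add_ac)
    finally show ?thesis .
  qed
  have x1: "2 * real n + 2 = x + 1" unfolding x_def by simp
  define c where "c = (fact n)\<^sup>2 * Gamma t / (x * Gamma (x + t))"
  have c0: "c \<noteq> 0" unfolding c_def G using G0 pochhammer_pos[OF assms, of "2*n+1"]
    by (simp add: x_def add_nonneg_eq_0_iff)
  define h where "h k = pochhammer (real n + 1) k * pochhammer (real n + 1) k * pochhammer x k
      / (fact k * pochhammer (x + 1) k * pochhammer (x + t) k) * 1 ^ k" for k
  have ch: "c * h k = sondow_term n t k" for k using summand unfolding c_def h_def .
  have "summable (\<lambda>k. c * h k)" unfolding ch by (rule summable_sondow_term[OF assms])
  then have "summable h" using c0 by (simp add: summable_cmult_iff)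
  then have "c * suminf h = suminf (sondow_term n t)"
    unfolding ch[symmetric] by (rule suminf_mult[symmetric])
  then show ?thesis
    unfolding sondow_integrand_def hypergeo_3F2_def x1 x_def[symmetric] c_def h_def .
qed

lemma sondow_integrand_sums:
  assumes "t > 0"
  shows "(\<lambda>\<nu>. sondow_density n (t + real \<nu>)) sums sondow_integrand n t"
proof -
  define G where "G s = suminf (sondow_term n s)" for s
  have step: "sondow_density n s = G s - G (s + 1)" if "s > 0" for s
    using sums_unique[OF sondow_term_step[OF that, of n]] suminf_diff[OF summable_sondow_term summable_sondow_term]
      that unfolding G_def by simp
  have part: "(\<Sum>\<nu><N. sondow_density n (t + real \<nu>)) = G t - G (t + real N)" for N
    using assms by (induction N) (simp_all add: step add_ac)
  have "(\<lambda>N. G (t + real N)) \<longlonglongrightarrow> 0"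
  proof (rule tendsto_sandwich[of "\<lambda>_. 0"])
    show "\<forall>\<^sub>F N in sequentially. 0 \<le> G (t + real N)"
      unfolding G_def using assms
      by (intro always_eventually allI suminf_nonneg summable_sondow_term sondow_term_nonneg) auto
    show "\<forall>\<^sub>F N in sequentially. G (t + real N) \<le> t / (t + real N) * G t"
    proof (intro always_eventually allI)
      fix N
      have "G (t + real N) \<le> (\<Sum>k. t / (t + real N) * sondow_term n t k)"
        unfolding G_def using assms
        by (intro suminf_le summable_mult summable_sondow_term sondow_term_shift) auto
      also have "\<dots> = t / (t + real N) * G t"
        unfolding G_def by (intro suminf_mult summable_sondow_term assms)
      finally show "G (t + real N) \<le> t / (t + real N) * G t" .
    qed
    have "(\<lambda>N. t / (t + real N)) \<longlonglongrightarrow> 0"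
      by (intro tendsto_divide_0[OF tendsto_const] filterlim_at_top_imp_at_infinity
          filterlim_tendsto_add_at_top[OF tendsto_const] filterlim_real_sequentially)
    then show "(\<lambda>N. t / (t + real N) * G t) \<longlonglongrightarrow> 0" by (rule tendsto_mult_left_zero)
  qed auto
  then have "(\<lambda>N. G t - G (t + real N)) \<longlonglongrightarrow> G t - 0" by (intro tendsto_intros)
  then show ?thesis
    unfolding sums_def part sondow_integrand_eq[OF assms] G_def by simp
qed

section \<open>Partial fractions\<close>

text \<open>If \<open>x\<close> is one of the nodes \<open>0, \<dots>, n\<close>, the corresponding summand is \<open>y / 0 = 0\<close>, that is,
  the sum skips it. With this convention the recursion below holds for all \<open>x\<close>.\<close>
definition binomial_fraction_sum :: "nat \<Rightarrow> real \<Rightarrow> real" where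
  "binomial_fraction_sum n x = (\<Sum>j\<le>n. (-1) ^ j * real (n choose j) / (real j - x))"

text \<open>Pascal's rule, after splitting off the summand \<open>j = 0\<close>, which is the same
  on both sides (and 0 if \<open>x = 0\<close>).\<close>

lemma binomial_fraction_sum_Suc:
  "binomial_fraction_sum (Suc n) x = binomial_fraction_sum n x - binomial_fraction_sum n (x - 1)"
proof -
  have "binomial_fraction_sum n x = (\<Sum>j\<le>Suc n. (-1) ^ j * real (n choose j) / (real j - x))"
    unfolding binomial_fraction_sum_def by simp
  also have "\<dots> = 1 / (- x) + (\<Sum>j\<le>n. (-1) ^ Suc j * real (n choose Suc j) / (real (Suc j) - x))"
    by (subst sum.atMost_Suc_shift) simp
  finally have 1: "binomial_fraction_sum n x = \<dots>" .
  have 2: "binomial_fraction_sum n (x - 1) = (\<Sum>j\<le>n. (-1) ^ j * real (n choose j) / (real (Suc j) - x))"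
    unfolding binomial_fraction_sum_def by (simp add: algebra_simps)
  have "binomial_fraction_sum (Suc n) x = 1 / (- x) +
      (\<Sum>j\<le>n. (-1) ^ Suc j * real (Suc n choose Suc j) / (real (Suc j) - x))"
    unfolding binomial_fraction_sum_def by (subst sum.atMost_Suc_shift) simp
  also have "\<dots> = 1 / (- x) + ((\<Sum>j\<le>n. (-1) ^ Suc j * real (n choose Suc j) / (real (Suc j) - x)) -
      (\<Sum>j\<le>n. (-1) ^ j * real (n choose j) / (real (Suc j) - x)))"
    unfolding sum_subtractf[symmetric]
    by (intro arg_cong2[of _ _ _ _ "(+)"] sum.cong refl)
      (simp add: diff_divide_distrib distrib_left)
  finally show ?thesis unfolding 1 2 by simp
qed

text \<open>Away from the nodes the sum is the partial fraction expansion of the right-hand side. In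
  the induction both fractions are brought to the denominator \<open>pochhammer s (n+2)\<close>,
  where the numerators differ by \<open>fact n * (n + 1)\<close>.\<close>

lemma binomial_fraction_sum_eq_pochhammer:
  assumes "\<And>j. j \<le> n \<Longrightarrow> s \<noteq> - real j"
  shows "binomial_fraction_sum n (- s) = fact n / pochhammer s (Suc n)"
  using assms
proof (induction n arbitrary: s)
  case 0
  then show ?case by (simp add: binomial_fraction_sum_def)
next
  case (Suc n)
  have s: "s \<noteq> - real j" if "j \<le> Suc n" for j using Suc.prems that .
  have s1: "s + 1 \<noteq> - real j" if "j \<le> n" for j using s[of "Suc j"] that by auto
  have nz: "pochhammer s (Suc n) \<noteq> 0" "pochhammer (s + 1) (Suc n) \<noteq> 0"
    using s s1 unfolding pochhammer_eq_0_iff by auto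
  have s0: "s \<noteq> 0" using s[of 0] by simp
  have sn: "s + real (Suc n) \<noteq> 0" using s[of "Suc n"] by linarith
  have P1: "pochhammer s (Suc (Suc n)) = s * pochhammer (s + 1) (Suc n)"
    by (rule pochhammer_rec)
  have P2: "pochhammer s (Suc (Suc n)) = (s + real (Suc n)) * pochhammer s (Suc n)"
    by (rule pochhammer_rec')
  have "binomial_fraction_sum (Suc n) (- s) = fact n / pochhammer s (Suc n) - fact n / pochhammer (s + 1) (Suc n)"
    using Suc.IH[of s] Suc.IH[of "s + 1"] s s1 by (simp add: binomial_fraction_sum_Suc)
  also have "fact n / pochhammer s (Suc n) = fact n * (s + real (Suc n)) / pochhammer s (Suc (Suc n))"
    unfolding P2 using sn nz by simp
  also have "fact n / pochhammer (s + 1) (Suc n) = fact n * s / pochhammer s (Suc (Suc n))"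
    unfolding P1 using s0 nz by simp
  finally show ?case
    by (simp only: diff_divide_distrib[symmetric]) (simp add: algebra_simps)
qed

text \<open>The value at a node, needed for the simple poles of the squared expansion. For
  \<open>k = 0\<close> and \<open>k = Suc n\<close> one argument in the recursion, -1 or n+1, is not
  a node for \<open>n\<close> and is evaluated by the closed form.\<close>

lemma binomial_fraction_sum_of_nat:
  assumes "k \<le> n"
  shows "binomial_fraction_sum n (real k) = (-1) ^ k * real (n choose k) * (harm k - harm (n - k))"
  using assms
proof (induction n arbitrary: k)
  case 0
  then show ?case by (simp add: binomial_fraction_sum_def)
next
  case (Suc n)
  consider "k = 0" | "k = Suc n" | j where "k = Suc j" "j < n"
    using Suc.prems by (cases k) (auto simp: less_Suc_eq_le le_less)
  then show ?case
  proof cases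
    case 1
    have "binomial_fraction_sum n (- 1) = 1 / real (Suc n)"
      by (subst binomial_fraction_sum_eq_pochhammer) (auto simp flip: pochhammer_fact)
    then show ?thesis
      using Suc.IH[of 0] 1 by (simp add: binomial_fraction_sum_Suc harm_Suc inverse_eq_divide)
  next
    case 2
    have neg: "1 / (- 1 - real n) = - (1 / (1 + real n))"
      using minus_divide_right[of 1 "1 + real n"] by simp
    have "binomial_fraction_sum n (- (- real (Suc n))) = (-1) ^ Suc n / real (Suc n)"
      by (subst binomial_fraction_sum_eq_pochhammer)
        (auto simp only: pochhammer_same fact_Suc, auto simp: minus_one_power_iff neg)
    then show ?thesis
      using Suc.IH[of n] 2
      by (simp add: binomial_fraction_sum_Suc harm_Suc inverse_eq_divide algebra_simps harm_expand)
  next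
    case 3
    define a b where "a = real (n choose Suc j)" and "b = real (n choose j)"
    have ab: "a * real (Suc j) = b * real (n - j)"
      unfolding a_def b_def using binomial_absorb_comp[of n j] binomial_absorption[of j n] 3
      by (metis mult.commute of_nat_mult)
    have h1: "harm (n - j) = harm (n - Suc j) + 1 / real (n - j)"
      using 3 harm_Suc[of "n - Suc j", where ?'a = real] by (simp add: Suc_diff_Suc inverse_eq_divide)
    have h2: "harm (Suc j) = harm j + 1 / real (Suc j)"
      by (simp add: harm_Suc inverse_eq_divide)
    \<comment> \<open>Absorption makes the two corrections cancel that arise from rewriting both
      induction hypotheses in terms of \<open>harm (Suc j) - harm (n - j)\<close>.\<close>
    have "a / real (n - j) = b / real (Suc j)"
      using ab 3 by (simp add: field_simps del: of_nat_Suc of_nat_diff)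
    then have "a * (harm (Suc j) - (harm (n - j) - 1 / real (n - j))) + b * (harm (Suc j) - 1 / real (Suc j) - harm (n - j))
      = (a + b) * (harm (Suc j) - harm (n - j))"
      by (simp add: algebra_simps)
    then show ?thesis
      using Suc.IH[of j] Suc.IH[of "Suc j"] 3 h1 h2
      unfolding a_def b_def
      by (simp add: binomial_fraction_sum_Suc algebra_simps)
  qed
qed

text \<open>The residue of \<open>sondow_density n\<close> at the double pole
  \<open>s = -k\<close>.\<close>

definition sondow_coeff :: "nat \<Rightarrow> nat \<Rightarrow> real" where
  "sondow_coeff n k = 2 * (real (n choose k))\<^sup>2 * (harm k - harm (n - k))"

lemma sondow_density_partial_fractions:
  assumes "s > 0"
  shows "sondow_density n s = (\<Sum>k\<le>n. (real (n choose k))\<^sup>2 / (s + k)\<^sup>2 + sondow_coeff n k / (s + k))"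
proof -
  define a where "a k = (-1) ^ k * real (n choose k)" for k
  have pos: "s + real k > 0" for k using assms by simp
  have "fact n / pochhammer s (Suc n) = (\<Sum>k\<le>n. a k / (s + k))"
    using binomial_fraction_sum_eq_pochhammer[of n s] assms
    unfolding binomial_fraction_sum_def a_def by (auto simp: add.commute)
  then have "sondow_density n s = (\<Sum>k\<le>n. \<Sum>j\<le>n. a k / (s + k) * (a j / (s + j)))"
    unfolding sondow_density_def power2_eq_square by (simp add: sum_product)
  \<comment> \<open>Off the diagonal, a product of two simple fractions is split into partial
    fractions. On the diagonal both quotients by \<open>j - k\<close> are \<open>y / 0 = 0\<close>,
    so only the double pole remains there. Exchanging the summation indices makes the two
    off-diagonal sums equal.\<close>
  also have "\<dots> = (\<Sum>k\<le>n. \<Sum>j\<le>n. (if j = k then (a k / (s + k))\<^sup>2 else 0) +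
      (a k / (s + k) * (a j / (real j - real k)) + a j / (s + j) * (a k / (real k - real j))))"
  proof (intro sum.cong refl)
    fix k j
    show "a k / (s + k) * (a j / (s + j)) = (if j = k then (a k / (s + k))\<^sup>2 else 0) +
      (a k / (s + k) * (a j / (real j - real k)) + a j / (s + j) * (a k / (real k - real j)))"
    proof (cases "j = k")
      case False
      then have d: "real j - real k \<noteq> 0" by simp
      have "a j / (s + j) * (a k / (real k - real j)) = - (a j / (s + j) * (a k / (real j - real k)))"
        by (metis minus_diff_eq minus_divide_right mult_minus_right)
      moreover have "x / p * (y / q) = x / p * (y / (q - p)) - y / q * (x / (q - p))"
        if "p \<noteq> 0" "q \<noteq> 0" "q - p \<noteq> 0" for x y p q :: real
        using that by (simp add: divide_simps) (simp add: algebra_simps)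
      from this[of "s + k" "s + j" "a k" "a j"]
      have "a k / (s + k) * (a j / (s + j)) =
          a k / (s + k) * (a j / (real j - real k)) - a j / (s + j) * (a k / (real j - real k))"
        using pos[of k] pos[of j] d by simp
      ultimately show ?thesis using False by simp
    qed (simp add: power2_eq_square)
  qed
  also have "\<dots> = (\<Sum>k\<le>n. (a k / (s + k))\<^sup>2) +
      ((\<Sum>k\<le>n. \<Sum>j\<le>n. a k / (s + k) * (a j / (real j - real k))) +
       (\<Sum>k\<le>n. \<Sum>j\<le>n. a j / (s + j) * (a k / (real k - real j))))"
    by (simp add: sum.distrib)
  also have "(\<Sum>k\<le>n. \<Sum>j\<le>n. a j / (s + j) * (a k / (real k - real j))) =
      (\<Sum>k\<le>n. \<Sum>j\<le>n. a k / (s + k) * (a j / (real j - real k)))"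
    by (rule sum.swap)
  also have "(\<Sum>k\<le>n. \<Sum>j\<le>n. a k / (s + k) * (a j / (real j - real k))) =
      (\<Sum>k\<le>n. a k / (s + k) * binomial_fraction_sum n (real k))"
    unfolding binomial_fraction_sum_def a_def by (simp add: sum_distrib_left)
  also have "(\<Sum>k\<le>n. (a k / (s + k))\<^sup>2) + ((\<Sum>k\<le>n. a k / (s + k) * binomial_fraction_sum n (real k)) +
      (\<Sum>k\<le>n. a k / (s + k) * binomial_fraction_sum n (real k))) =
      (\<Sum>k\<le>n. (a k / (s + k))\<^sup>2 + 2 * (a k / (s + k) * binomial_fraction_sum n (real k)))"
    by (simp add: sum.distrib sum_distrib_left)
  also have "\<dots> = (\<Sum>k\<le>n. (real (n choose k))\<^sup>2 / (s + k)\<^sup>2 + sondow_coeff n k / (s + k))"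
  proof (intro sum.cong refl)
    fix k assume "k \<in> {..n}"
    then have "binomial_fraction_sum n (real k) = a k * (harm k - harm (n - k))"
      using binomial_fraction_sum_of_nat[of k n] unfolding a_def by simp
    moreover have "(a k)\<^sup>2 = (real (n choose k))\<^sup>2"
      unfolding a_def by (simp add: power_mult_distrib flip: power_mult)
    moreover have "2 * (a k / (s + k) * (a k * (harm k - harm (n - k)))) = 2 * (a k)\<^sup>2 * (harm k - harm (n - k)) / (s + k)"
      by (simp add: power2_eq_square)
    ultimately show "(a k / (s + k))\<^sup>2 + 2 * (a k / (s + k) * binomial_fraction_sum n (real k)) =
        (real (n choose k))\<^sup>2 / (s + k)\<^sup>2 + sondow_coeff n k / (s + k)"
      unfolding sondow_coeff_def by (simp add: power_divide)
  qed
  finally show ?thesis .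
qed

lemma sondow_coeff_reflect: "k \<le> n \<Longrightarrow> sondow_coeff n (n - k) = - sondow_coeff n k"
  unfolding sondow_coeff_def by (simp add: binomial_symmetric[symmetric] algebra_simps)

lemma sum_sondow_coeff_reflect:
  assumes "m \<le> n"
  shows "(\<Sum>k=m..n. sondow_coeff n k) = - (\<Sum>k\<le>n-m. sondow_coeff n k)"
proof -
  have "(\<Sum>k=m..n. sondow_coeff n k) = (\<Sum>k\<le>n-m. sondow_coeff n (n - k))"
    by (rule sum.reindex_bij_witness[of _ "\<lambda>k. n - k" "\<lambda>k. n - k"]) (use assms in auto)
  also have "\<dots> = - (\<Sum>k\<le>n-m. sondow_coeff n k)"
    unfolding sum_negf[symmetric] by (intro sum.cong refl sondow_coeff_reflect) auto
  finally show ?thesis .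
qed

lemma sum_sondow_coeff: "(\<Sum>k\<le>n. sondow_coeff n k) = 0"
  using sum_sondow_coeff_reflect[of 0 n] by (simp add: atMost_atLeast0)

text \<open>Source of the index ranges in \<open>Sondow_S\<close>. The total sum is 0 and the
  coefficients are antisymmetric under \<open>k\<close> to \<open>n - k\<close>, so the tail is
  minus the initial sum up to \<open>m - 1\<close>, and equally up to \<open>n - m\<close>. Up to
  the smaller bound \<open>k \<le> n - k\<close> holds, so \<open>harm (n - k) - harm k\<close> is a
  sum of reciprocals.\<close>

lemma sum_sondow_coeff_tail:
  assumes "1 \<le> m" "m \<le> n"
  shows "(\<Sum>k=m..n. sondow_coeff n k) =
    (\<Sum>k=0..min (m - 1) (n - m). \<Sum>j=k+1..n-k. 2 * (real (n choose k))\<^sup>2 / real j)"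
proof -
  have split: "{..n} = {..m-1} \<union> {m..n}" using assms by auto
  have "(\<Sum>k\<le>n. sondow_coeff n k) = (\<Sum>k\<le>m-1. sondow_coeff n k) + (\<Sum>k=m..n. sondow_coeff n k)"
    unfolding split by (rule sum.union_disjoint) (use assms in auto)
  then have "(\<Sum>k=m..n. sondow_coeff n k) = - (\<Sum>k\<le>min (m - 1) (n - m). sondow_coeff n k)"
    using sum_sondow_coeff_reflect[OF assms(2)] sum_sondow_coeff[of n] by (auto simp: min_def)
  also have "\<dots> = (\<Sum>k=0..min (m - 1) (n - m). - sondow_coeff n k)"
    by (simp add: sum_negf atMost_atLeast0)
  also have "\<dots> = (\<Sum>k=0..min (m - 1) (n - m). \<Sum>j=k+1..n-k. 2 * (real (n choose k))\<^sup>2 / real j)"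
  proof (intro sum.cong refl)
    fix k assume k: "k \<in> {0..min (m - 1) (n - m)}"
    then have kn: "k \<le> n - k" using assms by auto
    then have split: "{1..n-k} = {1..k} \<union> {k+1..n-k}" by auto
    have "(harm (n - k) :: real) = harm k + (\<Sum>j=k+1..n-k. inverse (of_nat j))"
      unfolding harm_def split by (rule sum.union_disjoint) auto
    then show "- sondow_coeff n k = (\<Sum>j=k+1..n-k. 2 * (real (n choose k))\<^sup>2 / real j)"
      unfolding sondow_coeff_def by (simp add: divide_inverse sum_distrib_left[symmetric])
  qed
  finally show ?thesis .
qed

section \<open>Integration and the size of the integral\<close>

lemma has_integral_FTC_atLeast:
  fixes f F :: "real \<Rightarrow> real"
  assumes deriv: "\<And>x. a \<le> x \<Longrightarrow> (F has_real_derivative f x) (at x)"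
    and cont: "continuous_on {a..} f"
    and nonneg: "\<And>x. a \<le> x \<Longrightarrow> 0 \<le> f x"
    and lim: "(F \<longlongrightarrow> T) at_top"
  shows "(f has_integral (T - F a)) {a..}"
proof (rule has_integral_to_inf)
  show "f integrable_on {a..y}" for y
    by (rule integrable_continuous_interval, rule continuous_on_subset[OF cont]) auto
  have "F y - F a = integral {a..y} f" if "a \<le> y" for y
    using deriv that
    by (intro integral_unique[symmetric] fundamental_theorem_of_calculus)
      (auto intro: has_field_derivative_at_within simp: has_real_derivative_iff_has_vector_derivative[symmetric])
  then have "\<forall>\<^sub>F y in at_top. F y - F a = integral {a..y} f"
    by (intro eventually_mono[OF eventually_ge_at_top[of a]])
  moreover have "((\<lambda>y. F y - F a) \<longlongrightarrow> T - F a) at_top" by (intro tendsto_intros lim)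
  ultimately show "((\<lambda>y. integral {a..y} f) \<longlongrightarrow> T - F a) at_top"
    by (rule Lim_transform_eventually[rotated])
qed (fact nonneg)

lemma filterlim_add_const_at_top: "filterlim (\<lambda>t. t + c) at_top at_top" for c :: real
  using filterlim_tendsto_add_at_top[OF tendsto_const[of c] filterlim_ident] by (simp add: add.commute)

lemma tendsto_ln_add_diff: "((\<lambda>s. ln (s + c) - ln s) \<longlongrightarrow> 0) at_top" for c :: real
proof -
  have "((\<lambda>s. c / s) \<longlongrightarrow> 0) at_top"
    by (intro tendsto_divide_0[OF tendsto_const] filterlim_at_top_imp_at_infinity filterlim_ident)
  then have "((\<lambda>s. ln (1 + c / s)) \<longlongrightarrow> ln (1 + 0)) at_top"
    by (intro tendsto_intros) auto
  moreover have "\<forall>\<^sub>F s in at_top. ln (1 + c / s) = ln (s + c) - ln s"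
    using eventually_gt_at_top[of "max 0 (- c)"]
  proof eventually_elim
    case (elim s)
    then have "ln (1 + c / s) = ln ((s + c) / s)" by (simp add: add_divide_distrib)
    also have "\<dots> = ln (s + c) - ln s" using elim by (simp add: ln_div)
    finally show ?case .
  qed
  ultimately have "((\<lambda>s. ln (s + c) - ln s) \<longlongrightarrow> ln (1 + 0)) at_top"
    by (rule Lim_transform_eventually)
  then show ?thesis by simp
qed

text \<open>For \<open>s > 0\<close> this is the integral of \<open>sondow_density n\<close> over
  \<open>{s..}\<close>: minus the antiderivative that vanishes at infinity.\<close>

definition sondow_tail :: "nat \<Rightarrow> real \<Rightarrow> real" where
  "sondow_tail n s = (\<Sum>k\<le>n. (real (n choose k))\<^sup>2 / (s + k) - sondow_coeff n k * ln (s + k))"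

lemma sondow_density_nonneg: "sondow_density n s \<ge> 0"
  unfolding sondow_density_def by simp

lemma has_integral_sondow_density:
  assumes "a > 0"
  shows "((\<lambda>t. sondow_density n (t + real \<nu>)) has_integral sondow_tail n (a + real \<nu>)) {a..}"
proof -
  have "((\<lambda>t. sondow_density n (t + real \<nu>)) has_integral (0 - - sondow_tail n (a + real \<nu>))) {a..}"
  proof (rule has_integral_FTC_atLeast)
    fix x assume x: "a \<le> x"
    have pos: "x + real \<nu> + real k > 0" for k using assms x by linarith
    have "((\<lambda>t. - (c / (t + real \<nu> + real k) - b * ln (t + real \<nu> + real k))) has_real_derivative
        (c / (x + real \<nu> + real k)\<^sup>2 + b / (x + real \<nu> + real k))) (at x)" for b c k
      using pos[of k] by (auto intro!: derivative_eq_intros simp: power2_eq_square)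
    then have "((\<lambda>t. \<Sum>k\<le>n. - ((real (n choose k))\<^sup>2 / (t + real \<nu> + real k)
        - sondow_coeff n k * ln (t + real \<nu> + real k))) has_real_derivative
        (\<Sum>k\<le>n. (real (n choose k))\<^sup>2 / (x + real \<nu> + real k)\<^sup>2 + sondow_coeff n k / (x + real \<nu> + real k))) (at x)"
      by (intro DERIV_sum)
    then show "((\<lambda>t. - sondow_tail n (t + real \<nu>)) has_real_derivative sondow_density n (x + real \<nu>)) (at x)"
      using pos[of 0] by (simp only: sondow_tail_def sum_negf[symmetric] sondow_density_partial_fractions of_nat_0 add_0_right)
  next
    show "continuous_on {a..} (\<lambda>t. sondow_density n (t + real \<nu>))"
      unfolding sondow_density_def pochhammer_prod using assms
      by (intro continuous_intros) (auto simp: add_nonneg_eq_0_iff)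
  next
    \<comment> \<open>The coefficients sum to 0, so \<open>ln s\<close> may be subtracted from every
      logarithm; each difference then tends to 0.\<close>
    have eq: "sondow_tail n s = (\<Sum>k\<le>n. (real (n choose k))\<^sup>2 / (s + k) - sondow_coeff n k * (ln (s + k) - ln s))" for s
      using sum_sondow_coeff[of n] unfolding sondow_tail_def
      by (simp add: sum_subtractf right_diff_distrib sum_distrib_right[symmetric])
    have "(sondow_tail n \<longlongrightarrow> (\<Sum>k\<le>n. 0 - sondow_coeff n k * 0)) at_top"
      unfolding eq
    proof (intro tendsto_intros)
      fix k
      show "((\<lambda>s. (real (n choose k))\<^sup>2 / (s + real k)) \<longlongrightarrow> 0) at_top"
        by (intro tendsto_divide_0[OF tendsto_const] filterlim_at_top_imp_at_infinity
            filterlim_add_const_at_top)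
      show "((\<lambda>s. ln (s + real k) - ln s) \<longlongrightarrow> 0) at_top"
        by (rule tendsto_ln_add_diff)
    qed
    then have "(sondow_tail n \<longlongrightarrow> 0) at_top" by simp
    then have "((\<lambda>t. sondow_tail n (t + real \<nu>)) \<longlongrightarrow> 0) at_top"
      by (rule filterlim_compose[OF _ filterlim_add_const_at_top])
    then show "((\<lambda>t. - sondow_tail n (t + real \<nu>)) \<longlongrightarrow> 0) at_top"
      using tendsto_minus[of _ 0] by simp
  qed (rule sondow_density_nonneg)
  then show ?thesis by simp
qed

section \<open>Explicit bounds for the integrand and its integral\<close>

lemma sum_inverse_pochhammer:
  assumes "t > 0"
  shows "real n * (\<Sum>\<nu><N. 1 / pochhammer (t + real \<nu>) (Suc n)) = 1 / pochhammer t n - 1 / pochhammer (t + real N) n"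
proof (induction N)
  case (Suc N)
  define s where "s = t + real N"
  have s: "s > 0" using assms unfolding s_def by simp
  have p: "pochhammer s n > 0" "pochhammer (s + 1) n > 0" using s by (auto intro: pochhammer_pos)
  have "real n / pochhammer s (Suc n) = 1 / pochhammer s n - 1 / pochhammer (s + 1) n"
  proof -
    have "1 / pochhammer s n = (s + n) / pochhammer s (Suc n)"
      unfolding pochhammer_rec' using s p by simp
    moreover have "1 / pochhammer (s + 1) n = s / pochhammer s (Suc n)"
      unfolding pochhammer_rec using s p by simp
    ultimately show ?thesis by (simp only: diff_divide_distrib[symmetric]) simp
  qed
  then show ?case using Suc.IH unfolding s_def by (simp add: distrib_left add_ac)
qed simp

text \<open>The product is compared factor by factor with a power of \<open>t + n\<close>, whose
  reciprocal is easy to integrate. Equality holds at \<open>t = n + 1\<close>, the left end of the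
  integration range.\<close>

lemma pochhammer_ge:
  assumes "t \<ge> real n + 1"
  shows "pochhammer (real n + 1) n * ((t + n) / (2 * n + 1)) ^ n \<le> pochhammer t n"
proof -
  have "pochhammer (real n + 1) n * ((t + n) / (2 * n + 1)) ^ n =
      (\<Prod>i<n. (real n + 1 + i) * ((t + n) / (2 * n + 1)))"
    unfolding prod.distrib by (simp add: pochhammer_prod atLeast0LessThan)
  also have "\<dots> \<le> (\<Prod>i<n. t + i)"
  proof (rule prod_mono)
    fix i assume "i \<in> {..<n}"
    \<comment> \<open>This product is exactly the difference of the two sides of the next
      inequality.\<close>
    then have "0 \<le> (t - (real n + 1)) * (real n - real i)" using assms by simp
    then have "(real n + 1 + i) * (t + n) \<le> (t + i) * (2 * n + 1)" by (simp add: algebra_simps)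
    then show "0 \<le> (real n + 1 + i) * ((t + n) / (2 * n + 1)) \<and>
        (real n + 1 + i) * ((t + n) / (2 * n + 1)) \<le> t + i"
      using assms by (simp add: pos_divide_le_eq)
  qed
  finally show ?thesis by (simp add: pochhammer_prod atLeast0LessThan)
qed

definition sondow_const :: "nat \<Rightarrow> real" where
  "sondow_const n = (fact n)\<^sup>2 * (2 * real n + 1) ^ (2 * n) / (n * (pochhammer (real n + 1) n)\<^sup>2)"

text \<open>One of the two equal factors of the density is bounded by its value at
  \<open>\<nu> = 0\<close>; the sum over the other telescopes. Then \<open>pochhammer_ge\<close>
  replaces \<open>pochhammer t n\<close> by a power of \<open>t + n\<close>.\<close>

lemma sum_sondow_density_le:
  assumes "n > 0" "t \<ge> real n + 1"
  shows "(\<Sum>\<nu><N. sondow_density n (t + real \<nu>)) \<le> sondow_const n / (t + n) ^ (2 * n + 1)"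
proof -
  have t: "t > 0" using assms by simp
  have p: "pochhammer t n > 0" "pochhammer t (Suc n) > 0" using t by (auto intro: pochhammer_pos)
  have "(\<Sum>\<nu><N. sondow_density n (t + real \<nu>)) \<le>
      (\<Sum>\<nu><N. (fact n)\<^sup>2 / pochhammer t (Suc n) * (1 / pochhammer (t + real \<nu>) (Suc n)))"
  proof (rule sum_mono)
    fix \<nu>
    have q: "pochhammer (t + real \<nu>) (Suc n) > 0" using t by (intro pochhammer_pos) simp
    have "pochhammer t (Suc n) \<le> pochhammer (t + real \<nu>) (Suc n)"
      unfolding pochhammer_prod by (rule prod_mono) (use t in auto)
    then have "1 / pochhammer (t + real \<nu>) (Suc n) \<le> 1 / pochhammer t (Suc n)"
      using p by (intro divide_left_mono) (use q in auto)
    then have "(fact n)\<^sup>2 * (1 / pochhammer (t + real \<nu>) (Suc n)) * (1 / pochhammer (t + real \<nu>) (Suc n))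
      \<le> (fact n)\<^sup>2 * (1 / pochhammer t (Suc n)) * (1 / pochhammer (t + real \<nu>) (Suc n))"
      using q by (intro mult_right_mono mult_left_mono) auto
    then show "sondow_density n (t + real \<nu>) \<le> (fact n)\<^sup>2 / pochhammer t (Suc n) * (1 / pochhammer (t + real \<nu>) (Suc n))"
      unfolding sondow_density_def by (simp add: power2_eq_square)
  qed
  also have "\<dots> = (fact n)\<^sup>2 / pochhammer t (Suc n) * (\<Sum>\<nu><N. 1 / pochhammer (t + real \<nu>) (Suc n))"
    by (simp only: sum_distrib_left)
  also have "\<dots> \<le> (fact n)\<^sup>2 / pochhammer t (Suc n) * (1 / (n * pochhammer t n))"
  proof (rule mult_left_mono)
    have "pochhammer (t + real N) n > 0" using t by (intro pochhammer_pos) simp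
    then have "real n * (\<Sum>\<nu><N. 1 / pochhammer (t + real \<nu>) (Suc n)) \<le> 1 / pochhammer t n"
      unfolding sum_inverse_pochhammer[OF t] by simp
    then have "(\<Sum>\<nu><N. 1 / pochhammer (t + real \<nu>) (Suc n)) \<le> 1 / pochhammer t n / n"
      using assms(1) by (subst pos_le_divide_eq) (auto simp: mult.commute)
    then show "(\<Sum>\<nu><N. 1 / pochhammer (t + real \<nu>) (Suc n)) \<le> 1 / (n * pochhammer t n)"
      by (simp add: mult.commute)
  qed (use p in simp)
  also have "\<dots> = (fact n)\<^sup>2 / (n * (t + n)) / (pochhammer t n)\<^sup>2"
    unfolding pochhammer_rec' by (simp add: power2_eq_square mult_ac)
  also have "\<dots> \<le> (fact n)\<^sup>2 / (n * (t + n)) / (pochhammer (real n + 1) n * ((t + n) / (2 * n + 1)) ^ n)\<^sup>2"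
  proof (rule divide_left_mono)
    have pp: "pochhammer (real n + 1) n * ((t + n) / (2 * n + 1)) ^ n > 0"
      using t by (intro mult_pos_pos pochhammer_pos) auto
    show "0 < (pochhammer t n)\<^sup>2 * (pochhammer (real n + 1) n * ((t + n) / (2 * n + 1)) ^ n)\<^sup>2"
      by (rule mult_pos_pos[OF zero_less_power[OF p(1)] zero_less_power[OF pp]])
    show "(pochhammer (real n + 1) n * ((t + n) / (2 * n + 1)) ^ n)\<^sup>2 \<le> (pochhammer t n)\<^sup>2"
      using pochhammer_ge[OF assms(2)] pp by (intro power_mono) auto
  qed (use t in simp)
  also have "\<dots> = sondow_const n / (t + n) ^ (2 * n + 1)"
  proof -
    have w: "real (2 * n + 1) = 2 * real n + 1" by simp
    have x: "(t + n) ^ (2 * n + 1) = (t + n) * ((t + n) ^ n)\<^sup>2" by (simp add: power_even_eq)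
    show ?thesis
      unfolding sondow_const_def power_mult_distrib power_divide w x power_even_eq[of "2 * real n + 1"]
      by (simp add: mult_ac)
  qed
  finally show ?thesis .
qed

text \<open>At the left end \<open>t + n\<close> equals \<open>2n+1\<close>, which cancels the power
  in \<open>sondow_const\<close>. The rest simplifies because
  \<open>pochhammer (n+1) n / fact n\<close> is the central binomial coefficient.\<close>

lemma has_integral_sondow_bound:
  assumes "n > 0"
  shows "((\<lambda>t. sondow_const n / (t + n) ^ (2 * n + 1)) has_integral
    1 / (2 * (real n)\<^sup>2 * (real ((2 * n) choose n))\<^sup>2)) {real n + 1..}"
proof -
  have c0: "sondow_const n \<ge> 0" unfolding sondow_const_def by simp
  define F where "F t = - (sondow_const n / (2 * n)) * (1 / (t + real n) ^ (2 * n))" for t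
  have "((\<lambda>t. sondow_const n / (t + n) ^ (2 * n + 1)) has_integral (0 - F (real n + 1))) {real n + 1..}"
  proof (rule has_integral_FTC_atLeast)
    fix x assume x: "real n + 1 \<le> x"
    have xn: "x + real n \<noteq> 0" using x by linarith
    obtain m where m: "2 * n = Suc m" using assms by (cases "2 * n") auto
    define y where "y = x + real n"
    have y: "y > 0" unfolding y_def using x by linarith
    have "((\<lambda>t. (t + real n) ^ Suc m) has_real_derivative real (Suc m) * y ^ m) (at x)"
      unfolding y_def by (auto intro!: derivative_eq_intros simp del: power_Suc of_nat_Suc)
    moreover have "(x + real n) ^ Suc m \<noteq> 0" using xn by simp
    ultimately have "((\<lambda>t. inverse ((t + real n) ^ Suc m)) has_real_derivative
        - (real (Suc m) * y ^ m * inverse (((x + real n) ^ Suc m) ^ Suc (Suc 0)))) (at x)"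
      by (rule DERIV_inverse_fun)
    moreover have "real (Suc m) * y ^ m * inverse (((x + real n) ^ Suc m) ^ Suc (Suc 0)) =
        real (Suc m) / y ^ (Suc m + 1)"
    proof -
      have "((x + real n) ^ Suc m) ^ Suc (Suc 0) = y ^ m * y ^ (Suc m + 1)"
        unfolding y_def[symmetric] by simp
      then show ?thesis using y by (simp add: divide_inverse del: power_Suc of_nat_Suc)
    qed
    ultimately have "((\<lambda>t. 1 / (t + real n) ^ (2 * n)) has_real_derivative
        - (real (2 * n) / y ^ (2 * n + 1))) (at x)"
      unfolding m by (simp only: inverse_eq_divide)
    from DERIV_cmult[OF this, of "- (sondow_const n / (2 * n))"]
    show "(F has_real_derivative sondow_const n / (x + n) ^ (2 * n + 1)) (at x)"
      unfolding F_def[abs_def] y_def using assms by simp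
  next
    show "continuous_on {real n + 1..} (\<lambda>t. sondow_const n / (t + n) ^ (2 * n + 1))"
      by (intro continuous_intros) auto
  next
    have "((\<lambda>t::real. 1 / (t + real n) ^ (2 * n)) \<longlongrightarrow> 0) at_top"
      using assms by (intro tendsto_divide_0[OF tendsto_const] filterlim_at_top_imp_at_infinity
          filterlim_pow_at_top filterlim_add_const_at_top) auto
    then show "(F \<longlongrightarrow> 0) at_top"
      unfolding F_def[abs_def] by (rule tendsto_mult_right_zero)
  qed (use c0 in auto)
  moreover have "0 - F (real n + 1) = 1 / (2 * (real n)\<^sup>2 * (real ((2 * n) choose n))\<^sup>2)"
  proof -
    define P where "P = pochhammer (real n + 1) n"
    have P: "fact n * P = fact (2 * n)"
      unfolding P_def using fact_times_pochhammer[of n n] by (simp add: mult_2)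
    have "real ((2 * n) choose n) = fact (2 * n) / (fact n * fact n)"
      using binomial_fact[of n "2 * n", where ?'a = real] by (simp add: mult_2)
    also have "\<dots> = P / fact n" unfolding P[symmetric] by simp
    finally have C: "real ((2 * n) choose n) = P / fact n" .
    have P0: "P > 0" unfolding P_def by (intro pochhammer_pos) simp
    define w where "w = (2 * real n + 1) ^ (2 * n)"
    have w: "w > 0" unfolding w_def by simp
    have "real n + 1 + real n = 2 * real n + 1" by simp
    then have "0 - F (real n + 1) = (fact n)\<^sup>2 * w / (n * P\<^sup>2) / (2 * n) * (1 / w)"
      unfolding F_def sondow_const_def P_def[symmetric] w_def by simp
    also have "\<dots> = 1 / (2 * (real n)\<^sup>2 * (P / fact n)\<^sup>2)"
      using w assms P0 by (simp add: field_simps power2_eq_square)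
    finally show ?thesis unfolding C .
  qed
  ultimately show ?thesis by simp
qed

text \<open>Monotone convergence: the partial sums of the density series increase to the integrand,
  and their integrals lie between 0 and the explicit bound, which the limit inherits.\<close>

lemma sondow_I_limit:
  assumes "n > 0"
  shows "(\<lambda>N. \<Sum>\<nu><N. sondow_tail n (real n + 1 + real \<nu>)) \<longlonglongrightarrow> Sondow_I n"
    and "0 \<le> Sondow_I n"
    and "Sondow_I n \<le> 1 / (2 * (real n)\<^sup>2 * (real ((2 * n) choose n))\<^sup>2)" (is "_ \<le> ?J")
proof -
  define f where "f N t = (\<Sum>\<nu><N. sondow_density n (t + real \<nu>))" for N t
  define x where "x N = (\<Sum>\<nu><N. sondow_tail n (real n + 1 + real \<nu>))" for N
  have f: "(f N has_integral x N) {real n + 1..}" for N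
    unfolding f_def[abs_def] x_def by (intro has_integral_sum has_integral_sondow_density) auto
  have f0: "0 \<le> f N t" for N t
    unfolding f_def by (intro sum_nonneg sondow_density_nonneg)
  have x0: "0 \<le> x N" for N
    by (rule has_integral_nonneg[OF f]) (use f0 in auto)
  have xJ: "x N \<le> ?J" for N
    by (rule has_integral_le[OF f has_integral_sondow_bound[OF assms]])
      (use sum_sondow_density_le[OF assms] in \<open>auto simp: f_def\<close>)
  have xeq: "integral {real n + 1..} (f N) = x N" for N using f by (rule integral_unique)
  have "(sondow_integrand n) integrable_on {real n + 1..} \<and>
    (\<lambda>N. integral {real n + 1..} (f N)) \<longlonglongrightarrow> integral {real n + 1..} (sondow_integrand n)"
  proof (rule monotone_convergence_increasing)
    show "f N integrable_on {real n + 1..}" for N using f by blast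
    show "f N t \<le> f (Suc N) t" for N t unfolding f_def by (simp add: sondow_density_nonneg)
    show "(\<lambda>N. f N t) \<longlonglongrightarrow> sondow_integrand n t" if "t \<in> {real n + 1..}" for t
      using sondow_integrand_sums[of t n] that unfolding f_def sums_def by auto
    show "bounded (range (\<lambda>N. integral {real n + 1..} (f N)))"
      unfolding xeq bounded_iff using x0 xJ by (intro exI[of _ ?J]) (auto simp del: of_nat_mult)
  qed
  then have lim: "x \<longlonglongrightarrow> Sondow_I n"
    unfolding xeq Sondow_I_def sondow_integrand_def by simp
  then show "(\<lambda>N. \<Sum>\<nu><N. sondow_tail n (real n + 1 + real \<nu>)) \<longlonglongrightarrow> Sondow_I n"
    unfolding x_def[abs_def] .
  show "0 \<le> Sondow_I n" by (rule LIMSEQ_le_const[OF lim]) (use x0 in auto)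
  show "Sondow_I n \<le> ?J" by (rule LIMSEQ_le_const2[OF lim]) (use xJ in auto)
qed

section \<open>The linear form in the Euler constant and logarithms\<close>

definition sondow_log :: "nat \<Rightarrow> real" where
  "sondow_log n = (\<Sum>k\<le>n. sondow_coeff n k * (\<Sum>m=1..k. ln (real (n + m))))"

lemma sum_ln_shift:
  "(\<Sum>\<nu><N. ln (real n + 1 + real \<nu> + real k)) = (\<Sum>\<nu><N. ln (real n + 1 + real \<nu>)) +
    ((\<Sum>m=1..k. ln (real (n + m) + real N)) - (\<Sum>m=1..k. ln (real (n + m))))"
proof (induction k)
  case (Suc k)
  define g where "g \<nu> = ln (real n + 1 + real k + real \<nu>)" for \<nu>
  have "(\<Sum>\<nu><N. g (Suc \<nu>) - g \<nu>) = g N - g 0" by (rule sum_lessThan_telescope)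
  then have "(\<Sum>\<nu><N. ln (real n + 1 + real \<nu> + real (Suc k))) =
      (\<Sum>\<nu><N. ln (real n + 1 + real \<nu> + real k)) +
      (ln (real (n + Suc k) + real N) - ln (real (n + Suc k)))"
    unfolding g_def by (simp add: sum_subtractf algebra_simps)
  then show ?case using Suc.IH by (simp add: add_ac)
qed simp

lemma sum_inverse_shift: "(\<Sum>\<nu><N. 1 / (real n + 1 + real \<nu> + real k)) = harm (n + k + N) - harm (n + k)"
  by (induction N) (simp_all add: harm_Suc inverse_eq_divide add_ac)

text \<open>By \<open>sum_ln_shift\<close> all logarithmic sums share the part that is independent
  of \<open>k\<close>; it drops out because the coefficients sum to 0. Only \<open>k\<close>
  logarithms at each end survive.\<close>

lemma sum_sondow_tail:
  "(\<Sum>\<nu><N. sondow_tail n (real n + 1 + real \<nu>)) =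
    (\<Sum>k\<le>n. (real (n choose k))\<^sup>2 * (harm (n + k + N) - harm (n + k)))
    - (\<Sum>k\<le>n. sondow_coeff n k * (\<Sum>m=1..k. ln (real (n + m) + real N))) + sondow_log n"
proof -
  have "(\<Sum>\<nu><N. sondow_tail n (real n + 1 + real \<nu>)) =
      (\<Sum>k\<le>n. \<Sum>\<nu><N. (real (n choose k))\<^sup>2 * (1 / (real n + 1 + real \<nu> + real k))
        - sondow_coeff n k * ln (real n + 1 + real \<nu> + real k))"
    unfolding sondow_tail_def by (subst sum.swap) simp
  also have "\<dots> = (\<Sum>k\<le>n. (real (n choose k))\<^sup>2 * (\<Sum>\<nu><N. 1 / (real n + 1 + real \<nu> + real k)))
        - (\<Sum>k\<le>n. sondow_coeff n k * (\<Sum>\<nu><N. ln (real n + 1 + real \<nu> + real k)))"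
    by (simp add: sum_subtractf sum_distrib_left)
  also have "(\<Sum>k\<le>n. sondow_coeff n k * (\<Sum>\<nu><N. ln (real n + 1 + real \<nu> + real k))) =
      (\<Sum>k\<le>n. sondow_coeff n k) * (\<Sum>\<nu><N. ln (real n + 1 + real \<nu>)) +
      ((\<Sum>k\<le>n. sondow_coeff n k * (\<Sum>m=1..k. ln (real (n + m) + real N))) - sondow_log n)"
    unfolding sum_ln_shift sondow_log_def sum_distrib_right
    by (simp only: distrib_left right_diff_distrib sum.distrib sum_subtractf)
  finally show ?thesis unfolding sum_inverse_shift sum_sondow_coeff by simp
qed

text \<open>The coefficient of \<open>ln N\<close> in the asymptotic expansion of the partial sums is forced to vanish
  by their convergence.\<close>
lemma Sondow_I_eq:
  assumes "n > 0"
  shows "Sondow_I n = (\<Sum>k\<le>n. (real (n choose k))\<^sup>2) * euler_mascheroni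
    - (\<Sum>k\<le>n. (real (n choose k))\<^sup>2 * harm (n + k)) + sondow_log n"
proof -
  define W where "W = (\<Sum>k\<le>n. (real (n choose k))\<^sup>2)"
  \<comment> \<open>The coefficient of \<open>ln N\<close>: each harmonic number
    \<open>harm (n + k + N)\<close> contributes 1, and each of the \<open>k\<close> upper logarithms
    contributes 1 with weight \<open>- sondow_coeff n k\<close>.\<close>
  define \<kappa> where "\<kappa> = W - (\<Sum>k\<le>n. sondow_coeff n k * real k)"
  define x where "x N = (\<Sum>\<nu><N. sondow_tail n (real n + 1 + real \<nu>))" for N
  have lnlim: "(\<lambda>N. ln (real N + c) - ln (real N)) \<longlonglongrightarrow> 0" for c :: real
    by (rule filterlim_compose[OF tendsto_ln_add_diff filterlim_real_sequentially])
  have harmlim: "(\<lambda>N. harm (n + k + N) - ln (real N)) \<longlonglongrightarrow> euler_mascheroni" for k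
  proof -
    have "(\<lambda>N. harm (N + (n + k)) - ln (real (N + (n + k)))) \<longlonglongrightarrow> (euler_mascheroni :: real)"
      by (rule LIMSEQ_ignore_initial_segment[OF euler_mascheroni_LIMSEQ])
    from tendsto_add[OF this lnlim[of "real (n + k)"]] show ?thesis
      by (simp add: add.commute)
  qed
  have eq: "x N - \<kappa> * ln (real N) =
      (\<Sum>k\<le>n. (real (n choose k))\<^sup>2 * (harm (n + k + N) - ln (real N) - harm (n + k)))
      - (\<Sum>k\<le>n. sondow_coeff n k * (\<Sum>m=1..k. ln (real N + real (n + m)) - ln (real N))) + sondow_log n" for N
    unfolding x_def sum_sondow_tail \<kappa>_def W_def
    by (simp add: right_diff_distrib left_diff_distrib sum_subtractf sum_distrib_left mult_ac add.commute)
  have lim: "(\<lambda>N. x N - \<kappa> * ln (real N)) \<longlonglongrightarrow>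
      (\<Sum>k\<le>n. (real (n choose k))\<^sup>2 * (euler_mascheroni - harm (n + k)))
      - (\<Sum>k\<le>n. sondow_coeff n k * (\<Sum>m=1..k. 0)) + sondow_log n"
    unfolding eq by (intro tendsto_intros harmlim lnlim)
  have x: "x \<longlonglongrightarrow> Sondow_I n"
    using sondow_I_limit(1)[OF assms] unfolding x_def[abs_def] .
  have "\<kappa> = 0"
  proof (rule ccontr)
    assume k0: "\<kappa> \<noteq> 0"
    have "(\<lambda>N. (x N - (x N - \<kappa> * ln (real N))) / \<kappa>) \<longlonglongrightarrow> (Sondow_I n -
      ((\<Sum>k\<le>n. (real (n choose k))\<^sup>2 * (euler_mascheroni - harm (n + k)))
      - (\<Sum>k\<le>n. sondow_coeff n k * (\<Sum>m=1..k. 0)) + sondow_log n)) / \<kappa>"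
      by (intro tendsto_intros x lim k0)
    then have "convergent (\<lambda>N. ln (real N))" using k0 by (auto simp: convergent_def)
    moreover have "filterlim (\<lambda>N. ln (real N)) at_infinity sequentially"
      by (intro filterlim_at_top_imp_at_infinity filterlim_compose[OF ln_at_top filterlim_real_sequentially])
    ultimately show False
      using not_tendsto_and_filterlim_at_infinity[of sequentially] unfolding convergent_def by auto
  qed
  then have "x \<longlonglongrightarrow> (\<Sum>k\<le>n. (real (n choose k))\<^sup>2 * (euler_mascheroni - harm (n + k))) + sondow_log n"
    using lim by simp
  from LIMSEQ_unique[OF x this] show ?thesis
    by (simp add: right_diff_distrib sum_subtractf sum_distrib_right)
qed

section \<open>The logarithm of the integer product\<close>

lemma sondow_log_eq:
  "sondow_log n = (\<Sum>m=1..n. \<Sum>k=0..min (m - 1) (n - m). \<Sum>j=k+1..n-k.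
     2 * (real (n choose k))\<^sup>2 / real j * ln (real (n + m)))"
proof -
  have "sondow_log n = (\<Sum>k\<in>{..n}. \<Sum>m\<in>{m\<in>{1..n}. m \<le> k}. sondow_coeff n k * ln (real (n + m)))"
    unfolding sondow_log_def sum_distrib_left by (intro sum.cong refl) auto
  \<comment> \<open>Exchanging the sums makes the coefficient of \<open>ln (n + m)\<close> a tail
    sum of the \<open>sondow_coeff n k\<close>.\<close>
  also have "\<dots> = (\<Sum>m\<in>{1..n}. \<Sum>k\<in>{k\<in>{..n}. m \<le> k}. sondow_coeff n k * ln (real (n + m)))"
    by (rule sum.swap_restrict) auto
  also have "\<dots> = (\<Sum>m=1..n. (\<Sum>k=m..n. sondow_coeff n k) * ln (real (n + m)))"
    unfolding sum_distrib_right by (intro sum.cong refl) auto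
  also have "\<dots> = (\<Sum>m=1..n. \<Sum>k=0..min (m - 1) (n - m). \<Sum>j=k+1..n-k.
     2 * (real (n choose k))\<^sup>2 / real j * ln (real (n + m)))"
    by (intro sum.cong refl) (simp only: sum_sondow_coeff_tail sum_distrib_right atLeastAtMost_iff)
  finally show ?thesis .
qed

lemma ln_Sondow_S: "ln (real (Sondow_S n)) = real (lcm_upto (2 * n)) * sondow_log n"
proof -
  have "ln (real (Sondow_S n)) = (\<Sum>m=1..n. \<Sum>k=0..min (m - 1) (n - m). \<Sum>j=k+1..n-k.
      ln (real (n + m) ^ ((n choose k)\<^sup>2 * (2 * lcm_upto (2 * n) div j))))"
    unfolding Sondow_S_def of_nat_prod of_nat_power
    by (subst ln_prod; (intro sum.cong refl)?; (subst ln_prod)?; (intro sum.cong refl)?; (subst ln_prod)?)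
      auto
  also have "\<dots> = (\<Sum>m=1..n. \<Sum>k=0..min (m - 1) (n - m). \<Sum>j=k+1..n-k.
      real (lcm_upto (2 * n)) * (2 * (real (n choose k))\<^sup>2 / real j * ln (real (n + m))))"
  proof (intro sum.cong refl)
    fix m k j assume "m \<in> {1..n}" "j \<in> {k+1..n-k}"
    then have "j dvd 2 * lcm_upto (2 * n)" "real (n + m) > 0"
      by (auto intro!: dvd_mult dvd_lcm_upto)
    then show "ln (real (n + m) ^ ((n choose k)\<^sup>2 * (2 * lcm_upto (2 * n) div j))) =
      real (lcm_upto (2 * n)) * (2 * (real (n choose k))\<^sup>2 / real j * ln (real (n + m)))"
      by (simp add: ln_realpow real_of_nat_div)
  qed
  finally show ?thesis unfolding sondow_log_eq sum_distrib_left .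
qed

section \<open>Integrality and the criterion for the fractional part\<close>

lemma lcm_upto_harm_Ints:
  assumes "m \<le> N"
  shows "real (lcm_upto N) * harm m \<in> \<int>"
  unfolding harm_def sum_distrib_left
proof (rule Ints_sum)
  fix j assume "j \<in> {1..m}"
  then have "j dvd lcm_upto N" using assms by (intro dvd_lcm_upto) auto
  then obtain q where "lcm_upto N = j * q" ..
  then have "real (lcm_upto N) * inverse (real j) = real q" using \<open>j \<in> {1..m}\<close> by simp
  then show "real (lcm_upto N) * inverse (real j) \<in> \<int>" by simp
qed

text \<open>The estimates combine to \<open>1 / (2 * n)\<close>. The exponent \<open>2n-1\<close>
  instead of \<open>2n\<close> in the bound for the least common multiple saves a factor 4, so that
  the result is below 1 for every positive \<open>n\<close>.\<close>

lemma lcm_upto_Sondow_I_less: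
  assumes "n > 0"
  shows "real (lcm_upto (2 * n)) * Sondow_I n < 1"
proof -
  define C where "C = real ((2 * n) choose n)"
  have C: "C > 0" unfolding C_def by simp
  have n: "real n \<ge> 1" using assms by simp
  have "4 * lcm_upto (2 * n) \<le> 4 * 4 ^ (2 * n - 1)" using lcm_upto_le[of "2 * n"] assms by simp
  also have "(4 :: nat) * 4 ^ (2 * n - 1) = 4 ^ (2 * n)"
    using assms by (subst power_Suc[symmetric]) simp
  also have "(4 :: nat) ^ (2 * n) = 16 ^ n" by (simp add: power_mult)
  also have "\<dots> \<le> 4 * (n * ((2 * n) choose n)\<^sup>2)" using central_binomial_square_ge[OF assms] by simp
  finally have "lcm_upto (2 * n) \<le> n * ((2 * n) choose n)\<^sup>2" by simp
  then have d: "real (lcm_upto (2 * n)) \<le> n * C\<^sup>2"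
    unfolding C_def by (metis of_nat_le_iff of_nat_mult of_nat_power)
  have "real (lcm_upto (2 * n)) * Sondow_I n \<le> n * C\<^sup>2 * (1 / (2 * (real n)\<^sup>2 * C\<^sup>2))"
    using d sondow_I_limit(2,3)[OF assms] unfolding C_def by (intro mult_mono) auto
  also have "\<dots> = 1 / (2 * real n)" using C n by (simp add: power2_eq_square)
  also have "\<dots> < 1" using n by simp
  finally show ?thesis .
qed

text \<open>The range condition for a fractional part holds for every positive \<open>n\<close>, so
  only integrality of the difference is at stake. In that difference the logarithms cancel and the
  harmonic part is an integer.\<close>

lemma frac_ln_Sondow_S_iff:
  assumes "n > 0"
  shows "frac (ln (real (Sondow_S n))) = real (lcm_upto (2 * n)) * Sondow_I n \<longleftrightarrow>
    real (lcm_upto (2 * n) * ((2 * n) choose n)) * euler_mascheroni \<in> \<int>"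
proof -
  define d where "d = real (lcm_upto (2 * n))"
  define C where "C = real ((2 * n) choose n)"
  define A where "A = (\<Sum>k\<le>n. (real (n choose k))\<^sup>2 * harm (n + k))"
  have C: "(\<Sum>k\<le>n. (real (n choose k))\<^sup>2) = C"
    unfolding C_def choose_square_sum[symmetric] by simp
  have "d * A = (\<Sum>k\<le>n. (real (n choose k))\<^sup>2 * (d * harm (n + k)))"
    unfolding A_def by (simp add: sum_distrib_left mult_ac)
  also have "\<dots> \<in> \<int>"
    unfolding d_def by (intro Ints_sum Ints_mult Ints_power lcm_upto_harm_Ints) auto
  finally have dA: "d * A \<in> \<int>" .
  have "ln (real (Sondow_S n)) - d * Sondow_I n = d * A - d * C * euler_mascheroni"
    unfolding ln_Sondow_S Sondow_I_eq[OF assms] C d_def[symmetric] A_def[symmetric]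
    by (simp add: algebra_simps)
  moreover have "0 \<le> d * Sondow_I n" "d * Sondow_I n < 1"
    using sondow_I_limit(2)[OF assms] lcm_upto_Sondow_I_less[OF assms] unfolding d_def by auto
  ultimately have "frac (ln (real (Sondow_S n))) = d * Sondow_I n \<longleftrightarrow> d * A - d * C * euler_mascheroni \<in> \<int>"
    unfolding frac_unique_iff by simp
  also have "\<dots> \<longleftrightarrow> d * C * euler_mascheroni \<in> \<int>"
    using dA Ints_diff[of "d * A" "d * A - d * C * euler_mascheroni"] Ints_diff[of "d * A" "d * C * euler_mascheroni"]
    by auto
  finally show ?thesis unfolding d_def C_def by simp
qed

theorem theorem1:
  shows "((\<exists>n>0. frac (ln (real (Sondow_S n))) = real (lcm_upto (2 * n)) * Sondow_I n) \<longleftrightarrow>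
          (\<forall>\<^sub>F n in sequentially. frac (ln (real (Sondow_S n))) = real (lcm_upto (2 * n)) * Sondow_I n)) \<and>
         ((\<forall>\<^sub>F n in sequentially. frac (ln (real (Sondow_S n))) = real (lcm_upto (2 * n)) * Sondow_I n) \<longleftrightarrow>
          (euler_mascheroni :: real) \<in> \<rat>)"
proof -
  let ?P = "\<lambda>n. frac (ln (real (Sondow_S n))) = real (lcm_upto (2 * n)) * Sondow_I n"
  have rational: "(euler_mascheroni :: real) \<in> \<rat>" if ex: "\<exists>n>0. ?P n"
  proof -
    obtain n where n: "n > 0" "?P n" using ex by blast
    define q where "q = lcm_upto (2 * n) * ((2 * n) choose n)"
    have q: "real q \<noteq> 0" unfolding q_def using lcm_upto_pos[of "2 * n"] by simp
    have "real q * euler_mascheroni \<in> \<int>" using frac_ln_Sondow_S_iff[OF n(1)] n(2) unfolding q_def by blast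
    then have "real q * euler_mascheroni / real q \<in> \<rat>"
      by (intro Rats_divide) (auto simp: Ints_subset_Rats[THEN subsetD])
    then show ?thesis using q by simp
  qed
  have eventual: "\<forall>\<^sub>F n in sequentially. ?P n" if rat: "(euler_mascheroni :: real) \<in> \<rat>"
  proof -
    obtain p b :: int where b: "b > 0" "euler_mascheroni = real_of_int p / real_of_int b"
      using rat by (elim Rats_cases')
    define q where "q = nat b"
    have q: "q > 0" "euler_mascheroni = real_of_int p / real q" using b unfolding q_def by auto
    \<comment> \<open>As soon as \<open>n\<close> reaches the denominator \<open>q\<close>, this
      \<open>q\<close> is among the numbers up to \<open>2 * n\<close> and divides their least
      common multiple.\<close>
    show ?thesis using eventually_ge_at_top[of q]
    proof eventually_elim
      case (elim n)
      have "q dvd lcm_upto (2 * n)" using q elim by (intro dvd_lcm_upto) auto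
      then obtain r where r: "lcm_upto (2 * n) = q * r" ..
      have "real (lcm_upto (2 * n) * ((2 * n) choose n)) * euler_mascheroni =
          real_of_int (int r * int ((2 * n) choose n) * p)"
        unfolding q(2) r using q(1) by simp
      also have "\<dots> \<in> \<int>" by (rule Ints_of_int)
      finally show ?case using frac_ln_Sondow_S_iff[of n] elim q(1) by simp
    qed
  qed
  have exist: "\<exists>n>0. ?P n" if "\<forall>\<^sub>F n in sequentially. ?P n"
  proof -
    have "\<forall>\<^sub>F n in sequentially. n > 0 \<and> ?P n"
      using that eventually_gt_at_top[of 0] by eventually_elim simp
    then show ?thesis using eventually_happens by fastforce
  qed
  show ?thesis using rational eventual exist by blast
qed

end
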